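(* The permutations $2143$ and $2431$ form an annihilator pair: for every permutation $\tau$ and every pair of distinct indices $i,j\le|\tau|$, the permutation $\tau_{i,j}[2143,2431]$ satisfies $\mu[1,\tau_{i,j}[2143,2431]]=0$.
   Context: Permutations are ordered by containment: $\sigma\le\pi$ if $\pi$ has a subsequence order-isomorphic to $\sigma$. The Möbius function: $\mu[\sigma,\pi]=0$ if $\sigma\not\le\pi$, $\mu[\sigma,\pi]=1$ if $\sigma=\pi$, and $\mu[\sigma,\pi]=-\sum_{\sigma\le\tau<\pi}\mu[\sigma,\tau]$ otherwise; $1$ is the permutation of length one. For a permutation $\tau$ of length $m$, distinct indices $i,j\le m$ and non-empty permutations $\phi,\psi$, the inflation $\tau_{i,j}[\phi,\psi]$ is the permutation obtained from $\tau$ by replacing the entry $\tau_i$ by a block of $|\phi|$ consecutive positions whose values form a set of consecutive integers and are order-isomorphic to $\phi$, replacing $\tau_j$ likewise by a block order-isomorphic to $\psi$, and keeping every other entry as a single entry, so that the relative order between different blocks/entries is that of the corresponding entries of $\tau$. *)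

theory Defs
  imports Main "HOL-Library.Sublist"
begin

text \<open>A permutation of length \<open>n\<close> is written in one-line notation, with values \<open>1, \<dots>, n\<close>.
  Positions, as everywhere for lists, are counted from \<open>0\<close>.\<close>

definition is_perm :: "nat list \<Rightarrow> bool" where
  "is_perm \<pi> \<longleftrightarrow> distinct \<pi> \<and> set \<pi> = {1..length \<pi>}"

definition order_isomorphic :: "nat list \<Rightarrow> nat list \<Rightarrow> bool" where
  "order_isomorphic xs ys \<longleftrightarrow> length xs = length ys \<and>
     (\<forall>i<length xs. \<forall>j<length xs. xs ! i < xs ! j \<longleftrightarrow> ys ! i < ys ! j)"

definition perm_le :: "nat list \<Rightarrow> nat list \<Rightarrow> bool" (infix "\<preceq>" 50) where
  "\<sigma> \<preceq> \<pi> \<longleftrightarrow> is_perm \<sigma> \<and> is_perm \<pi> \<and> (\<exists>zs. subseq zs \<pi> \<and> order_isomorphic zs \<sigma>)"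

definition perm_less :: "nat list \<Rightarrow> nat list \<Rightarrow> bool" (infix "\<prec>" 50) where
  "\<sigma> \<prec> \<pi> \<longleftrightarrow> \<sigma> \<preceq> \<pi> \<and> \<sigma> \<noteq> \<pi>"

lemma is_perm_nth_eq_card:
  assumes "is_perm \<pi>" and "i < length \<pi>"
  shows "\<pi> ! i = Suc (card {j. j < length \<pi> \<and> \<pi> ! j < \<pi> ! i})"
proof -
  have d: "distinct \<pi>" and s: "set \<pi> = {1..length \<pi>}"
    using assms(1) by (auto simp: is_perm_def)
  have r: "\<pi> ! i \<in> {1..length \<pi>}"
    using s assms(2) nth_mem by metis
  have "(!) \<pi> ` {j. j < length \<pi> \<and> \<pi> ! j < \<pi> ! i} = {x \<in> set \<pi>. x < \<pi> ! i}"
    by (auto simp: in_set_conv_nth)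
  also have "\<dots> = {1..<\<pi> ! i}"
    using r by (auto simp: s)
  finally have "card ((!) \<pi> ` {j. j < length \<pi> \<and> \<pi> ! j < \<pi> ! i}) = \<pi> ! i - 1"
    by simp
  moreover have "inj_on ((!) \<pi>) {j. j < length \<pi> \<and> \<pi> ! j < \<pi> ! i}"
    using d by (auto simp: inj_on_def nth_eq_iff_index_eq)
  ultimately show ?thesis
    using r by (simp add: card_image)
qed

lemma order_isomorphic_perm_eq:
  assumes "is_perm \<sigma>" "is_perm \<pi>" "order_isomorphic \<pi> \<sigma>"
  shows "\<sigma> = \<pi>"
proof (rule nth_equalityI)
  show len: "length \<sigma> = length \<pi>"
    using assms(3) by (simp add: order_isomorphic_def)
  fix i assume i: "i < length \<sigma>"
  have "{j. j < length \<sigma> \<and> \<sigma> ! j < \<sigma> ! i} = {j. j < length \<pi> \<and> \<pi> ! j < \<pi> ! i}"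
    using assms(3) i by (auto simp: order_isomorphic_def)
  then show "\<sigma> ! i = \<pi> ! i"
    using is_perm_nth_eq_card[OF assms(1) i] is_perm_nth_eq_card[OF assms(2), of i] i len by simp
qed

lemma perm_less_length:
  assumes "\<sigma> \<prec> \<pi>"
  shows "length \<sigma> < length \<pi>"
proof -
  obtain zs where zs: "subseq zs \<pi>" "order_isomorphic zs \<sigma>"
    and p: "is_perm \<sigma>" "is_perm \<pi>" and ne: "\<sigma> \<noteq> \<pi>"
    using assms by (auto simp: perm_less_def perm_le_def)
  have len: "length zs = length \<sigma>"
    using zs(2) by (simp add: order_isomorphic_def)
  have "length zs \<noteq> length \<pi>"
    using zs p ne order_isomorphic_perm_eq[OF p] subseq_same_length by metis
  then show ?thesis
    using list_emb_length[OF zs(1)] len by simp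
qed

lemma finite_perm_le: "finite {\<sigma>. \<sigma> \<preceq> \<pi>}"
proof (rule finite_subset)
  show "{\<sigma>. \<sigma> \<preceq> \<pi>} \<subseteq> {\<sigma>. set \<sigma> \<subseteq> {1..length \<pi>} \<and> length \<sigma> \<le> length \<pi>}"
  proof
    fix \<sigma> assume "\<sigma> \<in> {\<sigma>. \<sigma> \<preceq> \<pi>}"
    then have le: "\<sigma> \<preceq> \<pi>" by simp
    have "length \<sigma> \<le> length \<pi>"
      using le perm_less_length[of \<sigma> \<pi>] by (cases "\<sigma> = \<pi>") (auto simp: perm_less_def)
    then show "\<sigma> \<in> {\<sigma>. set \<sigma> \<subseteq> {1..length \<pi>} \<and> length \<sigma> \<le> length \<pi>}"
      using le by (auto simp: perm_le_def is_perm_def)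
  qed
  show "finite {\<sigma>. set \<sigma> \<subseteq> {1..length \<pi>} \<and> length \<sigma> \<le> length \<pi>}"
    by (rule finite_lists_length_le) simp
qed

function mobius :: "nat list \<Rightarrow> nat list \<Rightarrow> int" where
  "mobius \<sigma> \<pi> =
     (if \<not> \<sigma> \<preceq> \<pi> then 0
      else if \<sigma> = \<pi> then 1
      else - (\<Sum>\<tau> \<in> {\<tau>. \<sigma> \<preceq> \<tau> \<and> \<tau> \<prec> \<pi>}. mobius \<sigma> \<tau>))"
  by pat_completeness auto
termination
  by (relation "measure (\<lambda>(\<sigma>, \<pi>). length \<pi>)") (auto simp: perm_less_length)

declare mobius.simps [simp del]

text \<open>In the inflation of \<open>\<tau>\<close> by the blocks \<open>b 0, b 1, \<dots>\<close> the values of the block at position \<open>k\<close>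
  lie directly above those of all blocks at positions \<open>l\<close> with \<open>\<tau> ! l < \<tau> ! k\<close>.\<close>

definition block_offset :: "nat list \<Rightarrow> (nat \<Rightarrow> nat list) \<Rightarrow> nat \<Rightarrow> nat" where
  "block_offset \<tau> b k = (\<Sum>l | l < length \<tau> \<and> \<tau> ! l < \<tau> ! k. length (b l))"

definition inflation :: "nat list \<Rightarrow> (nat \<Rightarrow> nat list) \<Rightarrow> nat list" where
  "inflation \<tau> b = concat (map (\<lambda>k. map (\<lambda>x. block_offset \<tau> b k + x) (b k)) [0..<length \<tau>])"

definition inflation2 :: "nat list \<Rightarrow> nat \<Rightarrow> nat \<Rightarrow> nat list \<Rightarrow> nat list \<Rightarrow> nat list" where
  "inflation2 \<tau> i j \<phi> \<psi> = inflation \<tau> ((\<lambda>_. [1])(i := \<phi>, j := \<psi>))"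

lemma block_offset_less:
  assumes "k < length \<tau>" and "\<tau> ! k < \<tau> ! k'"
  shows "block_offset \<tau> b k + length (b k) \<le> block_offset \<tau> b k'"
proof -
  have "block_offset \<tau> b k + length (b k)
      = (\<Sum>l\<in>insert k {l. l < length \<tau> \<and> \<tau> ! l < \<tau> ! k}. length (b l))"
    by (simp add: block_offset_def)
  also have "\<dots> \<le> block_offset \<tau> b k'"
    unfolding block_offset_def using assms by (intro sum_mono2) auto
  finally show ?thesis .
qed

lemma is_perm_inflation:
  assumes \<tau>: "is_perm \<tau>" and b: "\<And>k. k < length \<tau> \<Longrightarrow> is_perm (b k)"
  shows "is_perm (inflation \<tau> b)"
proof -
  let ?B = "\<lambda>k. map (\<lambda>x. block_offset \<tau> b k + x) (b k)"
  have len: "length (inflation \<tau> b) = (\<Sum>l<length \<tau>. length (b l))"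
    by (simp add: inflation_def length_concat comp_def interv_sum_list_conv_sum_set_nat
        atLeast0LessThan)
  have lo: "block_offset \<tau> b k < x \<and> x \<le> block_offset \<tau> b k + length (b k)"
    if "k < length \<tau>" "x \<in> set (?B k)" for k x
    using that b[OF that(1)] by (auto simp: is_perm_def)
  have tot: "block_offset \<tau> b k + length (b k) \<le> (\<Sum>l<length \<tau>. length (b l))"
    if "k < length \<tau>" for k
  proof -
    have "block_offset \<tau> b k + length (b k)
        = (\<Sum>l\<in>insert k {l. l < length \<tau> \<and> \<tau> ! l < \<tau> ! k}. length (b l))"
      by (simp add: block_offset_def)
    also have "\<dots> \<le> (\<Sum>l<length \<tau>. length (b l))"
      using that by (intro sum_mono2) auto
    finally show ?thesis .
  qed
  have disj: "set (?B k) \<inter> set (?B k') = {}"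
    if "k < length \<tau>" "k' < length \<tau>" "k \<noteq> k'" for k k'
  proof -
    have "\<tau> ! k < \<tau> ! k' \<or> \<tau> ! k' < \<tau> ! k"
      using \<tau> that by (metis is_perm_def linorder_neqE_nat nth_eq_iff_index_eq)
    then show ?thesis
      using block_offset_less[of k \<tau> k' b] block_offset_less[of k' \<tau> k b] lo that
      by (meson disjoint_iff le_trans not_le)
  qed
  have dis: "distinct (concat (map ?B [0..<n]))" if "n \<le> length \<tau>" for n
    using that
  proof (induction n)
    case (Suc n)
    have "distinct (?B n)"
      using b[of n] Suc.prems by (simp add: is_perm_def distinct_map)
    moreover have "set (concat (map ?B [0..<n])) \<inter> set (?B n) = {}"
    proof -
      have "set (?B k) \<inter> set (?B n) = {}" if "k \<in> {0..<n}" for k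
        using disj[of k n] Suc.prems that by simp
      then have "(\<Union>k\<in>{0..<n}. set (?B k)) \<inter> set (?B n) = {}"
        by blast
      then show ?thesis by (simp only: set_concat set_map image_image set_upt)
    qed
    ultimately show ?case
      using Suc by simp
  qed simp
  have "distinct (inflation \<tau> b)"
    using dis[of "length \<tau>"] by (simp add: inflation_def)
  moreover have "set (inflation \<tau> b) \<subseteq> {1..length (inflation \<tau> b)}"
  proof
    fix x assume "x \<in> set (inflation \<tau> b)"
    then obtain k where "k < length \<tau>" "x \<in> set (?B k)"
      by (auto simp: inflation_def)
    then show "x \<in> {1..length (inflation \<tau> b)}"
      using lo[of k x] tot[of k] by (simp add: len)
  qed
  ultimately show ?thesis
    unfolding is_perm_def by (simp add: card_subset_eq distinct_card)
qed

definition annihilator_pair :: "nat list \<Rightarrow> nat list \<Rightarrow> bool" where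
  "annihilator_pair \<phi> \<psi> \<longleftrightarrow>
     is_perm \<phi> \<and> is_perm \<psi> \<and> \<phi> \<noteq> [] \<and> \<psi> \<noteq> [] \<and>
     (\<forall>\<tau> i j. is_perm \<tau> \<longrightarrow> i < length \<tau> \<longrightarrow> j < length \<tau> \<longrightarrow> i \<noteq> j \<longrightarrow>
        mobius [1] (inflation2 \<tau> i j \<phi> \<psi>) = 0)"

end

(* Embeddings are studied up to permutations with vanishing Moebius value, which contribute nothing
   to sums of mu. Over the set of all permutations contained in a fixed one of length at least 2, mu
   sums to 0; so mu(pi) is minus the sum over the proper subpermutations of pi.

   Write phi = 2143, psi = 2431, and let D(a, b) be the set of permutations contained in the result
   of replacing the two blocks of pi by a and b. A member of D(a, b) either contains a as an interval
   or lies in D(a', b) for a one-point deletion a' of a; likewise for b. Induction on the length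
   disposes of those containing both intervals. In this way the following have vanishing mu, with
   set identities up to permutations with vanishing mu and proper subpermutations on the left:
   - intervals 12 and 21:  D(1,21) Un D(12,1), with intersection D(1,1);
   - interval 321:  the permutations below the one with 321 replaced by 21;
   - intervals 213 and psi:  K Un L Un V with K = D(21,psi), L = D(213,132), V = D(12,231), where
     K Int V = D(1,231), L Int V = D(12,12) Un D(1,21), and K Int L exceeds K Int L Int V by
     D(21,132) minus (D(1,12) Un D(1,21));
   - intervals phi and psi:  D(phi,132) Un D(132,psi), with intersection D(132,132).
   Inclusion-exclusion then gives sum 0 in each case. *)

theory Submission
  imports Defs
begin

section \<open>Finite point sets and their embeddings\<close>

lemma subseq_map_nth:
  fixes f :: "nat \<Rightarrow> nat"
  assumes mono: "\<And>i j. i < j \<Longrightarrow> j < n \<Longrightarrow> f i < f j"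
    and bound: "\<And>i. i < n \<Longrightarrow> f i < length ys"
  shows "subseq (map (\<lambda>k. ys ! f k) [0..<n]) ys"
proof -
  have sorted: "sorted_wrt (<) (map f [0..<n])"
    using mono by (simp add: sorted_wrt_iff_nth_less)
  \<comment> \<open>A strictly sorted list is determined by its set, so the chosen indices form a
    filtered list of all indices, and a filtered list is a subsequence.\<close>
  have "map f [0..<n] = filter (\<lambda>k. k \<in> f ` {..<n}) [0..<length ys]"
  proof (rule strict_sorted_equal[OF _ sorted])
    show "sorted_wrt (<) (filter (\<lambda>k. k \<in> f ` {..<n}) [0..<length ys])"
      by (simp add: sorted_wrt_filter)
    show "set (map f [0..<n]) = set (filter (\<lambda>k. k \<in> f ` {..<n}) [0..<length ys])"
      using bound by auto
  qed
  then have "subseq (map f [0..<n]) [0..<length ys]"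
    by (metis subseq_filter_left)
  then have "subseq (map ((!) ys) (map f [0..<n])) (map ((!) ys) [0..<length ys])"
    by (rule subseq_map)
  then show ?thesis
    by (simp add: map_nth comp_def)
qed

lemma subseq_obtain_indices:
  assumes "subseq zs ys"
  obtains f :: "nat \<Rightarrow> nat" where "\<And>i j. i < j \<Longrightarrow> j < length zs \<Longrightarrow> f i < f j"
    and "\<And>i. i < length zs \<Longrightarrow> f i < length ys \<and> zs ! i = ys ! f i"
proof -
  have "\<exists>f :: nat \<Rightarrow> nat. (\<forall>i j. i < j \<longrightarrow> j < length zs \<longrightarrow> f i < f j) \<and>
      (\<forall>i < length zs. f i < length ys \<and> zs ! i = ys ! f i)"
    using assms
  proof (induction zs ys rule: list_emb.induct)
    case (list_emb_Nil ys)
    show ?case by simp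
  next
    case (list_emb_Cons xs ys y)
    then obtain f :: "nat \<Rightarrow> nat" where
      "\<forall>i j. i < j \<longrightarrow> j < length xs \<longrightarrow> f i < f j"
      "\<forall>i < length xs. f i < length ys \<and> xs ! i = ys ! f i" by blast
    then show ?case by (intro exI[of _ "\<lambda>i. Suc (f i)"]) simp
  next
    case (list_emb_Cons2 x y xs ys)
    then obtain f :: "nat \<Rightarrow> nat" where f:
      "\<forall>i j. i < j \<longrightarrow> j < length xs \<longrightarrow> f i < f j"
      "\<forall>i < length xs. f i < length ys \<and> xs ! i = ys ! f i" by blast
    with list_emb_Cons2.hyps(1) show ?case
      by (intro exI[of _ "\<lambda>i. case i of 0 \<Rightarrow> 0 | Suc i \<Rightarrow> Suc (f i)"])
        (auto simp: nth_Cons split: nat.splits)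
  qed
  then show ?thesis using that by blast
qed

section \<open>Plots of permutations and order embeddings\<close>

type_synonym points = "(nat \<times> nat) set"

definition generic :: "points \<Rightarrow> bool" where
  "generic C \<longleftrightarrow> finite C \<and> inj_on fst C \<and> inj_on snd C"

definition order_embedding :: "(nat \<times> nat \<Rightarrow> nat \<times> nat) \<Rightarrow> points \<Rightarrow> points \<Rightarrow> bool" where
  "order_embedding h C D \<longleftrightarrow> h ` C \<subseteq> D \<and>
     (\<forall>P\<in>C. \<forall>Q\<in>C. (fst P < fst Q \<longleftrightarrow> fst (h P) < fst (h Q)) \<and>
                   (snd P < snd Q \<longleftrightarrow> snd (h P) < snd (h Q)))"

definition embeds :: "points \<Rightarrow> points \<Rightarrow> bool" (infix "\<sqsubseteq>" 50) where
  "C \<sqsubseteq> D \<longleftrightarrow> (\<exists>h. order_embedding h C D)"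

text \<open>The plot of \<alpha> moved to the corner (x, y). Positions start at 0 and values at 1,
  so the occupied columns start at x and the occupied rows at y + 1.\<close>

definition graph :: "nat \<Rightarrow> nat \<Rightarrow> nat list \<Rightarrow> points" where
  "graph x y \<alpha> = (\<lambda>k. (x + k, y + \<alpha> ! k)) ` {..<length \<alpha>}"

lemma graphE:
  assumes "P \<in> graph x y \<alpha>"
  obtains k where "k < length \<alpha>" "P = (x + k, y + \<alpha> ! k)"
  using assms by (auto simp: graph_def)

lemma graphI: "k < length \<alpha> \<Longrightarrow> (x + k, y + \<alpha> ! k) \<in> graph x y \<alpha>"
  by (auto simp: graph_def)

lemma order_embedding_comp:
  "order_embedding g C D \<Longrightarrow> order_embedding h D E \<Longrightarrow> order_embedding (h \<circ> g) C E"
  unfolding order_embedding_def image_subset_iff comp_def by metis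

lemma embeds_trans [trans]: "C \<sqsubseteq> D \<Longrightarrow> D \<sqsubseteq> E \<Longrightarrow> C \<sqsubseteq> E"
  unfolding embeds_def using order_embedding_comp by blast

lemma order_embedding_superset: "order_embedding h C D \<Longrightarrow> D \<subseteq> E \<Longrightarrow> order_embedding h C E"
  by (auto simp: order_embedding_def)

lemma subset_imp_embeds: "C \<subseteq> D \<Longrightarrow> C \<sqsubseteq> D"
  unfolding embeds_def order_embedding_def by (intro exI[of _ id]) auto

lemma embeds_refl [simp]: "C \<sqsubseteq> C"
  by (simp add: subset_imp_embeds)

lemma embeds_inverse:
  assumes "order_embedding h C D" and "h ` C = D"
  shows "D \<sqsubseteq> C"
proof -
  have "order_embedding (inv_into C h) D C"
    using assms by (auto simp: order_embedding_def inv_into_into f_inv_into_f)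
  then show ?thesis by (auto simp: embeds_def)
qed

lemma order_embedding_inj_on:
  assumes "order_embedding h C D" and "generic C"
  shows "inj_on h C"
proof (rule inj_onI)
  fix P Q assume "P \<in> C" "Q \<in> C" "h P = h Q"
  then have "fst P = fst Q"
    using assms(1) by (metis less_irrefl linorder_neqE_nat order_embedding_def)
  then show "P = Q"
    using assms(2) \<open>P \<in> C\<close> \<open>Q \<in> C\<close> by (auto simp: generic_def inj_on_def)
qed

lemma embeds_card_le:
  assumes "C \<sqsubseteq> D" "generic C" "finite D"
  shows "card C \<le> card D"
proof -
  obtain h where h: "order_embedding h C D" using assms by (auto simp: embeds_def)
  then show ?thesis
    using card_inj_on_le[OF order_embedding_inj_on[OF h assms(2)] _ assms(3)]
    by (auto simp: order_embedding_def)
qed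

lemma card_graph [simp]: "card (graph x y \<alpha>) = length \<alpha>"
  unfolding graph_def by (subst card_image) (auto simp: inj_on_def)

lemma is_perm_nth_bounds:
  assumes "is_perm \<alpha>" "k < length \<alpha>"
  shows "1 \<le> \<alpha> ! k" "\<alpha> ! k \<le> length \<alpha>"
  using assms nth_mem[of k \<alpha>] by (auto simp: is_perm_def)

lemma is_perm_nth_inject:
  "is_perm \<alpha> \<Longrightarrow> k < length \<alpha> \<Longrightarrow> l < length \<alpha> \<Longrightarrow> \<alpha> ! k = \<alpha> ! l \<longleftrightarrow> k = l"
  by (auto simp: is_perm_def nth_eq_iff_index_eq)

lemma generic_graph: "is_perm \<alpha> \<Longrightarrow> generic (graph x y \<alpha>)"
  unfolding generic_def graph_def by (auto simp: inj_on_def is_perm_nth_inject)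

text \<open>The bridge from subsequences to plots: an increasing index map and an order embedding
  carry the same information, since a position determines its point in a plot.\<close>

lemma perm_le_iff_embeds:
  assumes "is_perm \<sigma>" "is_perm \<rho>"
  shows "\<sigma> \<preceq> \<rho> \<longleftrightarrow> graph 0 0 \<sigma> \<sqsubseteq> graph 0 0 \<rho>"
proof
  assume "\<sigma> \<preceq> \<rho>"
  then obtain zs where zs: "subseq zs \<rho>" "order_isomorphic zs \<sigma>" by (auto simp: perm_le_def)
  then have len: "length zs = length \<sigma>" by (simp add: order_isomorphic_def)
  obtain f :: "nat \<Rightarrow> nat" where f: "\<And>i j. i < j \<Longrightarrow> j < length zs \<Longrightarrow> f i < f j"
    "\<And>i. i < length zs \<Longrightarrow> f i < length \<rho> \<and> zs ! i = \<rho> ! f i"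
    using subseq_obtain_indices[OF zs(1)] by blast
  have fm: "i < j \<longleftrightarrow> f i < f j" if "i < length \<sigma>" "j < length \<sigma>" for i j
    using f(1) that len by (metis linorder_neqE_nat less_asym')
  have fv: "\<sigma> ! i < \<sigma> ! j \<longleftrightarrow> \<rho> ! f i < \<rho> ! f j" if "i < length \<sigma>" "j < length \<sigma>" for i j
    using zs(2) f(2) that len unfolding order_isomorphic_def by metis
  have "order_embedding (\<lambda>P. (f (fst P), \<rho> ! f (fst P))) (graph 0 0 \<sigma>) (graph 0 0 \<rho>)"
    using f(2) fm fv len by (auto simp: order_embedding_def graph_def)
  then show "graph 0 0 \<sigma> \<sqsubseteq> graph 0 0 \<rho>" by (auto simp: embeds_def)
next
  assume "graph 0 0 \<sigma> \<sqsubseteq> graph 0 0 \<rho>"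
  then obtain h where h: "order_embedding h (graph 0 0 \<sigma>) (graph 0 0 \<rho>)"
    by (auto simp: embeds_def)
  define f where "f k = fst (h (k, \<sigma> ! k))" for k
  have f: "f k < length \<rho> \<and> h (k, \<sigma> ! k) = (f k, \<rho> ! f k)" if "k < length \<sigma>" for k
  proof -
    have "h (k, \<sigma> ! k) \<in> graph 0 0 \<rho>"
      using h that by (auto simp: order_embedding_def graph_def)
    then show ?thesis by (auto simp: f_def graph_def)
  qed
  have fm: "(i < j \<longleftrightarrow> f i < f j) \<and> (\<sigma> ! i < \<sigma> ! j \<longleftrightarrow> \<rho> ! f i < \<rho> ! f j)"
    if "i < length \<sigma>" "j < length \<sigma>" for i j
    using h that f[of i] f[of j] by (auto simp: order_embedding_def graph_def)
  have "subseq (map (\<lambda>k. \<rho> ! f k) [0..<length \<sigma>]) \<rho>"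
  proof (rule subseq_map_nth)
    show "f i < f j" if "i < j" "j < length \<sigma>" for i j
      using fm[of i j] that by simp
    show "f i < length \<rho>" if "i < length \<sigma>" for i
      using f[OF that] by simp
  qed
  moreover have "order_isomorphic (map (\<lambda>k. \<rho> ! f k) [0..<length \<sigma>]) \<sigma>"
    using fm by (auto simp: order_isomorphic_def)
  ultimately show "\<sigma> \<preceq> \<rho>" using assms by (auto simp: perm_le_def)
qed

section \<open>Standardisation of generic point sets\<close>

lemma card_rank_less_iff:
  fixes f :: "'a \<Rightarrow> nat"
  assumes "finite C" "P \<in> C" "Q \<in> C"
  shows "card {R \<in> C. f R \<le> f P} < card {R \<in> C. f R \<le> f Q} \<longleftrightarrow> f P < f Q"
proof -
  have lt: "card {R \<in> C. f R \<le> f A} < card {R \<in> C. f R \<le> f B}"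
    if "A \<in> C" "B \<in> C" "f A < f B" for A B
  proof (rule psubset_card_mono)
    show "finite {R \<in> C. f R \<le> f B}" using assms(1) by simp
    have "B \<in> {R \<in> C. f R \<le> f B} - {R \<in> C. f R \<le> f A}" using that by simp
    moreover have "{R \<in> C. f R \<le> f A} \<subseteq> {R \<in> C. f R \<le> f B}" using that by auto
    ultimately show "{R \<in> C. f R \<le> f A} \<subset> {R \<in> C. f R \<le> f B}" by blast
  qed
  have le: "card {R \<in> C. f R \<le> f B} \<le> card {R \<in> C. f R \<le> f A}" if "f B \<le> f A" for A B
    using that assms(1) by (intro card_mono) auto
  show ?thesis
    using lt[OF assms(2,3)] le[of Q P] by linarith
qed

text \<open>Ranks preserve and reflect the order in each coordinate, so both coordinates of every
  point may be replaced by their ranks.\<close>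

lemma standardisation_exists:
  assumes "generic C"
  obtains \<rho> where "is_perm \<rho>" "length \<rho> = card C" "graph 0 0 \<rho> \<sqsubseteq> C" "C \<sqsubseteq> graph 0 0 \<rho>"
proof -
  define n where "n = card C"
  define xs where "xs = sorted_list_of_set (fst ` C)"
  \<comment> \<open>\<open>pt k\<close> is the point with exactly k points to its left. The rank
    \<open>r\<close> counts the point itself, so that values run from 1 to n.\<close>
  define pt where "pt k = inv_into C fst (xs ! k)" for k
  define r :: "nat \<times> nat \<Rightarrow> nat" where "r P = card {R \<in> C. snd R \<le> snd P}" for P
  define \<rho> where "\<rho> = map (\<lambda>k. r (pt k)) [0..<n]"
  have fin: "finite C" and i1: "inj_on fst C" and i2: "inj_on snd C"
    using assms by (auto simp: generic_def)
  have lxs: "length xs = n"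
    using i1 by (simp add: xs_def n_def card_image)
  have sxs: "set xs = fst ` C" using fin by (simp add: xs_def)
  have pt: "pt k \<in> C" "fst (pt k) = xs ! k" if "k < n" for k
  proof -
    have "xs ! k \<in> fst ` C" using that lxs sxs nth_mem by metis
    then show "pt k \<in> C" "fst (pt k) = xs ! k"
      unfolding pt_def by (auto intro: inv_into_into f_inv_into_f)
  qed
  have mono: "xs ! i < xs ! j" if "i < j" "j < n" for i j
    using that lxs by (auto simp: xs_def intro!: sorted_wrt_nth_less[of "(<)"])
  then have mono_iff: "i < j \<longleftrightarrow> xs ! i < xs ! j" if "i < n" "j < n" for i j
    using that by (metis linorder_neqE_nat less_asym')
  have r: "r P < r Q \<longleftrightarrow> snd P < snd Q" if "P \<in> C" "Q \<in> C" for P Q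
    unfolding r_def using card_rank_less_iff[OF fin that] .
  have emb: "order_embedding (\<lambda>P. pt (fst P)) (graph 0 0 \<rho>) C"
    unfolding order_embedding_def graph_def \<rho>_def using pt r mono_iff by auto
  have img: "(\<lambda>P. pt (fst P)) ` graph 0 0 \<rho> = C"
  proof
    show "(\<lambda>P. pt (fst P)) ` graph 0 0 \<rho> \<subseteq> C"
      using emb by (simp add: order_embedding_def)
    show "C \<subseteq> (\<lambda>P. pt (fst P)) ` graph 0 0 \<rho>"
    proof
      fix P assume P: "P \<in> C"
      then obtain k where k: "k < n" "xs ! k = fst P"
        using sxs lxs by (metis imageI in_set_conv_nth)
      then have "pt k = P" using P i1 by (simp add: pt_def)
      then show "P \<in> (\<lambda>P. pt (fst P)) ` graph 0 0 \<rho>"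
        using k by (force simp: graph_def \<rho>_def)
    qed
  qed
  have "distinct \<rho>"
  proof -
    have "r (pt i) \<noteq> r (pt j)" if ij: "i < n" "j < n" "i \<noteq> j" for i j
    proof
      assume "r (pt i) = r (pt j)"
      then have "snd (pt i) = snd (pt j)"
        using r pt(1) ij by (metis less_irrefl linorder_neqE_nat)
      then have "pt i = pt j" using i2 pt(1) ij by (auto simp: inj_on_def)
      then show False using mono ij pt(2) by (metis less_irrefl linorder_neqE_nat)
    qed
    then show ?thesis by (auto simp: \<rho>_def distinct_conv_nth)
  qed
  moreover have "set \<rho> \<subseteq> {1..n}"
  proof -
    have "r P \<in> {1..n}" if "P \<in> C" for P
    proof -
      have "P \<in> {R \<in> C. snd R \<le> snd P}" "finite {R \<in> C. snd R \<le> snd P}"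
        using that fin by simp_all
      then have "0 < card {R \<in> C. snd R \<le> snd P}" by (metis card_gt_0_iff empty_iff)
      moreover have "card {R \<in> C. snd R \<le> snd P} \<le> n"
        unfolding n_def using fin by (intro card_mono) auto
      ultimately show ?thesis by (simp add: r_def)
    qed
    then have "r (pt k) \<in> {1..n}" if "k < n" for k using pt(1) that by blast
    then show ?thesis unfolding \<rho>_def by force
  qed
  moreover have "length \<rho> = n" by (simp add: \<rho>_def)
  ultimately have "is_perm \<rho>"
    unfolding is_perm_def by (simp add: card_subset_eq distinct_card)
  then show ?thesis
    using that[of \<rho>] emb embeds_inverse[OF emb img] \<open>length \<rho> = n\<close>
    by (auto simp: embeds_def n_def)
qed

section \<open>Principal ideals and sums of the Moebius function\<close>

text \<open>For generic \<open>C\<close> this is a principal ideal, generated by the standardisation of \<open>C\<close>.\<close>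

definition below :: "points \<Rightarrow> nat list set" where
  "below C = {\<sigma>. is_perm \<sigma> \<and> graph 0 0 \<sigma> \<sqsubseteq> C}"

abbreviation mu :: "nat list \<Rightarrow> int" where
  "mu \<equiv> mobius [1]"

lemma below_mono: "A \<sqsubseteq> B \<Longrightarrow> below A \<subseteq> below B"
  using embeds_trans by (auto simp: below_def)

lemma below_eq_principal:
  assumes "generic C"
  obtains \<rho> where "is_perm \<rho>" "length \<rho> = card C" "below C = {\<sigma>. \<sigma> \<preceq> \<rho>}"
proof -
  obtain \<rho> where \<rho>: "is_perm \<rho>" "length \<rho> = card C" "graph 0 0 \<rho> \<sqsubseteq> C" "C \<sqsubseteq> graph 0 0 \<rho>"
    using standardisation_exists[OF assms] .
  have "below C = {\<sigma>. \<sigma> \<preceq> \<rho>}"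
    using \<rho> perm_le_iff_embeds[OF _ \<rho>(1)] embeds_trans
    by (auto simp: below_def) (auto simp: perm_le_def)
  then show ?thesis using that \<rho> by blast
qed

lemma finite_below: "generic C \<Longrightarrow> finite (below C)"
  by (metis below_eq_principal finite_perm_le)

lemma length_le_card_below:
  assumes "\<sigma> \<in> below C" "finite C"
  shows "length \<sigma> \<le> card C"
  using embeds_card_le[of "graph 0 0 \<sigma>" C] assms generic_graph by (simp add: below_def)

lemma mu_not_perm: "\<not> is_perm \<sigma> \<Longrightarrow> mu \<sigma> = 0"
  by (simp add: mobius.simps perm_le_def)

text \<open>The recursion for \<open>mu \<rho>\<close> with all terms on one side; the length bound
  excludes \<rho> = [1], where the total would be 1.\<close>

lemma sum_mu_principal:
  assumes "is_perm \<rho>" "2 \<le> length \<rho>"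
  shows "mu \<rho> + (\<Sum>\<sigma> \<in> {\<sigma>. \<sigma> \<preceq> \<rho>} - {\<rho>}. mu \<sigma>) = 0"
proof -
  have one: "is_perm [1]" by (simp add: is_perm_def)
  have "order_embedding (\<lambda>_. (0, \<rho> ! 0)) (graph 0 0 [1]) (graph 0 0 \<rho>)"
    using assms(2) by (auto simp: order_embedding_def graph_def image_iff)
  then have le: "[1] \<preceq> \<rho>"
    using perm_le_iff_embeds[OF one assms(1)] by (auto simp: embeds_def)
  have "mu \<rho> = - (\<Sum>\<tau> \<in> {\<tau>. [1] \<preceq> \<tau> \<and> \<tau> \<prec> \<rho>}. mu \<tau>)"
    using le assms(2) by (subst mobius.simps) auto
  \<comment> \<open>The right-hand index set also contains the empty permutation, which does not
    contain [1]; there \<open>mu\<close> has its default value 0.\<close>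
  also have "(\<Sum>\<tau> \<in> {\<tau>. [1] \<preceq> \<tau> \<and> \<tau> \<prec> \<rho>}. mu \<tau>) = (\<Sum>\<sigma> \<in> {\<sigma>. \<sigma> \<preceq> \<rho>} - {\<rho>}. mu \<sigma>)"
    using finite_perm_le[of \<rho>]
    by (intro sum.mono_neutral_left) (auto simp: perm_less_def mobius.simps)
  finally show ?thesis by simp
qed

lemma sum_mu_below:
  assumes "generic C" "2 \<le> card C"
  shows "sum mu (below C) = 0"
proof -
  obtain \<rho> where \<rho>: "is_perm \<rho>" "length \<rho> = card C" "below C = {\<sigma>. \<sigma> \<preceq> \<rho>}"
    using below_eq_principal[OF assms(1)] .
  have "\<rho> \<in> {\<sigma>. \<sigma> \<preceq> \<rho>}"
    using perm_le_iff_embeds[OF \<rho>(1) \<rho>(1)] by simp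
  then show ?thesis
    using sum_mu_principal[of \<rho>] \<rho> assms(2) finite_perm_le[of \<rho>]
    by (simp add: sum.remove)
qed

lemma mu_eq_neg_sum_strictly_below:
  assumes "is_perm \<pi>" "2 \<le> length \<pi>"
  shows "mu \<pi> = - sum mu (below (graph 0 0 \<pi>) - {\<pi>})"
proof -
  have "below (graph 0 0 \<pi>) = {\<sigma>. \<sigma> \<preceq> \<pi>}"
    using perm_le_iff_embeds[OF _ assms(1)] by (auto simp: below_def perm_le_def)
  then show ?thesis using sum_mu_principal[OF assms] by simp
qed

lemma strictly_below_length:
  assumes "is_perm \<pi>" "\<sigma> \<in> below (graph 0 0 \<pi>)" "\<sigma> \<noteq> \<pi>"
  shows "length \<sigma> < length \<pi>"
  using assms perm_le_iff_embeds[of \<sigma> \<pi>] perm_less_length[of \<sigma> \<pi>]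
  by (auto simp: below_def perm_less_def)

section \<open>Intervals\<close>

text \<open>The two ranges are half-open on opposite sides because positions of a plot start at 0
  and values at 1.\<close>

definition box :: "nat \<Rightarrow> nat \<Rightarrow> nat \<Rightarrow> points" where
  "box x y m = {x..<x + m} \<times> {y<..y + m}"

text \<open>All columns and rows of the box are forbidden, not just the box itself: each point of C
  then compares in the same way with every point of the box.\<close>

definition avoids :: "points \<Rightarrow> nat \<Rightarrow> nat \<Rightarrow> nat \<Rightarrow> bool" where
  "avoids C x y m \<longleftrightarrow> (\<forall>P\<in>C. fst P \<notin> {x..<x + m} \<and> snd P \<notin> {y<..y + m})"

lemma graph_subset_box:
  "is_perm \<alpha> \<Longrightarrow> length \<alpha> \<le> m \<Longrightarrow> graph x y \<alpha> \<subseteq> box x y m"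
  using is_perm_nth_bounds[of \<alpha>] by (fastforce simp: graph_def box_def)

lemma generic_Un:
  assumes "generic C" "generic A" "avoids C x y m" "A \<subseteq> box x y m"
  shows "generic (C \<union> A)"
proof -
  have "fst P \<noteq> fst Q \<and> snd P \<noteq> snd Q" if "P \<in> C" "Q \<in> A" for P Q
    using assms(3,4) that by (fastforce simp: avoids_def box_def)
  then have "fst ` (C - A) \<inter> fst ` (A - C) = {}" "snd ` (C - A) \<inter> snd ` (A - C) = {}"
    by auto
  then show ?thesis
    using assms(1,2) by (simp add: generic_def inj_on_Un)
qed

text \<open>Points of C cannot tell the points of the box apart, so an embedding inside the box
  extends by the identity on C.\<close>

lemma embeds_Un_box:
  assumes "A \<sqsubseteq> B" "A \<subseteq> box x y m" "B \<subseteq> box x y m" "avoids C x y m"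
  shows "C \<union> A \<sqsubseteq> C \<union> B"
proof -
  obtain h where h: "order_embedding h A B" using assms(1) by (auto simp: embeds_def)
  define g where "g P = (if P \<in> A then h P else P)" for P
  have hA: "x \<le> fst (h P) \<and> fst (h P) < x + m \<and> y < snd (h P) \<and> snd (h P) \<le> y + m"
    if "P \<in> A" for P
  proof -
    have "h P \<in> box x y m" using that h assms(3) by (auto simp: order_embedding_def)
    then show ?thesis by (auto simp: box_def)
  qed
  have A: "x \<le> fst P \<and> fst P < x + m \<and> y < snd P \<and> snd P \<le> y + m" if "P \<in> A" for P
    using assms(2) that by (auto simp: box_def)
  have C: "(fst P < x \<or> x + m \<le> fst P) \<and> (snd P \<le> y \<or> y + m < snd P)" if "P \<in> C" for P
    using assms(4) that by (auto simp: avoids_def not_le not_less)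
  have ord: "(fst P < fst Q \<longleftrightarrow> fst (g P) < fst (g Q)) \<and> (snd P < snd Q \<longleftrightarrow> snd (g P) < snd (g Q))"
    if PQ: "P \<in> C \<union> A" "Q \<in> C \<union> A" for P Q
  proof -
    consider "P \<in> A" "Q \<in> A" | "P \<in> A" "Q \<notin> A" "Q \<in> C" | "P \<notin> A" "P \<in> C" "Q \<in> A"
      | "P \<notin> A" "Q \<notin> A" using PQ by auto
    then show ?thesis
    proof cases
      case 1 then show ?thesis using h by (auto simp: g_def order_embedding_def)
    next
      case 2 then show ?thesis using A[of P] hA[of P] C[of Q] by (auto simp: g_def)
    next
      case 3 then show ?thesis using A[of Q] hA[of Q] C[of P] by (auto simp: g_def)
    next
      case 4 then show ?thesis by (simp add: g_def)
    qed
  qed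
  have "g ` (C \<union> A) \<subseteq> C \<union> B" using h by (auto simp: g_def order_embedding_def)
  then have "order_embedding g (C \<union> A) (C \<union> B)"
    using ord by (simp add: order_embedding_def)
  then show ?thesis by (auto simp: embeds_def)
qed

section \<open>One-point deletions\<close>

definition delete :: "nat \<Rightarrow> nat list \<Rightarrow> nat list" where
  "delete i \<alpha> = map (\<lambda>v. if \<alpha> ! i < v then v - 1 else v) (take i \<alpha> @ drop (Suc i) \<alpha>)"

lemma length_delete: "i < length \<alpha> \<Longrightarrow> length (delete i \<alpha>) = length \<alpha> - 1"
  by (simp add: delete_def)

lemma nth_delete:
  assumes "i < length \<alpha>" "k < length (delete i \<alpha>)"
  shows "delete i \<alpha> ! k = (let v = \<alpha> ! (if k < i then k else Suc k) in if \<alpha> ! i < v then v - 1 else v)"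
  using assms by (auto simp: delete_def nth_append min_def)

lemma is_perm_delete:
  assumes "is_perm \<alpha>" "i < length \<alpha>"
  shows "is_perm (delete i \<alpha>)"
proof -
  \<comment> \<open>\<open>s k\<close> is the position in \<alpha> of the k-th remaining entry, and
    \<open>d\<close> closes the gap in the values; \<open>d\<close> is injective away from the
    deleted value.\<close>
  define s where "s k = (if k < i then k else Suc k)" for k
  define d where "d v = (if \<alpha> ! i < v then v - 1 else v)" for v
  have nth: "delete i \<alpha> ! k = d (\<alpha> ! s k)" if "k < length (delete i \<alpha>)" for k
    using nth_delete[OF assms(2) that] by (simp add: s_def d_def Let_def)
  have s: "s k < length \<alpha>" "\<alpha> ! s k \<noteq> \<alpha> ! i" if "k < length (delete i \<alpha>)" for k
  proof -
    show *: "s k < length \<alpha>" using that assms(2) by (auto simp: s_def length_delete)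
    have "s k \<noteq> i" by (auto simp: s_def)
    then show "\<alpha> ! s k \<noteq> \<alpha> ! i" using is_perm_nth_inject[OF assms(1) * assms(2)] by simp
  qed
  have inj: "delete i \<alpha> ! k \<noteq> delete i \<alpha> ! l"
    if kl: "k < length (delete i \<alpha>)" "l < length (delete i \<alpha>)" "k \<noteq> l" for k l
  proof
    assume "delete i \<alpha> ! k = delete i \<alpha> ! l"
    then have "\<alpha> ! s k = \<alpha> ! s l"
      using s(2)[OF kl(1)] s(2)[OF kl(2)] by (auto simp: nth kl d_def split: if_splits)
    then have "s k = s l" using is_perm_nth_inject[OF assms(1)] s(1) kl by blast
    then show False using kl(3) by (auto simp: s_def split: if_splits)
  qed
  have "set (delete i \<alpha>) \<subseteq> {1..length (delete i \<alpha>)}"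
  proof
    fix v assume "v \<in> set (delete i \<alpha>)"
    then obtain k where k: "k < length (delete i \<alpha>)" "v = delete i \<alpha> ! k"
      by (metis in_set_conv_nth)
    then show "v \<in> {1..length (delete i \<alpha>)}"
      using s[OF k(1)] is_perm_nth_bounds[OF assms(1) assms(2)]
        is_perm_nth_bounds[OF assms(1) s(1)[OF k(1)]]
      by (auto simp: nth d_def length_delete[OF assms(2)])
  qed
  moreover have "distinct (delete i \<alpha>)" using inj by (auto simp: distinct_conv_nth)
  ultimately show ?thesis unfolding is_perm_def by (simp add: card_subset_eq distinct_card)
qed

text \<open>Reopening the closed gaps keeps all comparisons. The image is recorded exactly, so that
  an embedding can be extracted in either direction.\<close>

lemma delete_embedding:
  assumes "is_perm \<alpha>" "i < length \<alpha>"
  shows "\<exists>h. order_embedding h (graph x y (delete i \<alpha>)) (graph x y \<alpha> - {(x + i, y + \<alpha> ! i)}) \<and>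
    h ` graph x y (delete i \<alpha>) = graph x y \<alpha> - {(x + i, y + \<alpha> ! i)}"
proof -
  define s where "s k = (if k < i then k else Suc k)" for k
  define d where "d v = (if \<alpha> ! i < v then v - 1 else v)" for v
  define h where "h P = (x + s (fst P - x), y + \<alpha> ! s (fst P - x))" for P :: "nat \<times> nat"
  have sl: "s k < length \<alpha> \<and> s k \<noteq> i" if "k < length (delete i \<alpha>)" for k
    using that assms(2) by (auto simp: s_def length_delete)
  have nth: "delete i \<alpha> ! k = d (\<alpha> ! s k)" if "k < length (delete i \<alpha>)" for k
    using nth_delete[OF assms(2) that] by (simp add: s_def d_def Let_def)
  have d: "d v < d w \<longleftrightarrow> v < w" if "v \<noteq> \<alpha> ! i" "w \<noteq> \<alpha> ! i" for v w
    using that by (auto simp: d_def)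
  have ne: "\<alpha> ! s k \<noteq> \<alpha> ! i" if "k < length (delete i \<alpha>)" for k
    using sl[OF that] is_perm_nth_inject[OF assms(1) _ assms(2)] by simp
  have s_mono: "s k < s l \<longleftrightarrow> k < l" for k l by (auto simp: s_def)
  have img: "h ` graph x y (delete i \<alpha>) = graph x y \<alpha> - {(x + i, y + \<alpha> ! i)}"
  proof
    show "h ` graph x y (delete i \<alpha>) \<subseteq> graph x y \<alpha> - {(x + i, y + \<alpha> ! i)}"
      using sl by (auto simp: graph_def h_def)
    show "graph x y \<alpha> - {(x + i, y + \<alpha> ! i)} \<subseteq> h ` graph x y (delete i \<alpha>)"
    proof
      fix P assume "P \<in> graph x y \<alpha> - {(x + i, y + \<alpha> ! i)}"
      then obtain k where k: "k < length \<alpha>" "P = (x + k, y + \<alpha> ! k)" "k \<noteq> i"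
        by (auto elim: graphE)
      define l where "l = (if k < i then k else k - 1)"
      have l: "l < length (delete i \<alpha>)" "s l = k"
        using k assms(2) by (auto simp: l_def s_def length_delete)
      then have "P = h (x + l, y + delete i \<alpha> ! l)" using k by (simp add: h_def)
      then show "P \<in> h ` graph x y (delete i \<alpha>)" using l graphI by blast
    qed
  qed
  moreover have "order_embedding h (graph x y (delete i \<alpha>)) (graph x y \<alpha> - {(x + i, y + \<alpha> ! i)})"
    unfolding order_embedding_def
  proof (intro conjI ballI)
    show "h ` graph x y (delete i \<alpha>) \<subseteq> graph x y \<alpha> - {(x + i, y + \<alpha> ! i)}" using img by simp
    fix P Q assume "P \<in> graph x y (delete i \<alpha>)" "Q \<in> graph x y (delete i \<alpha>)"
    then obtain k l where "k < length (delete i \<alpha>)" "l < length (delete i \<alpha>)"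
      "P = (x + k, y + delete i \<alpha> ! k)" "Q = (x + l, y + delete i \<alpha> ! l)"
      by (auto elim!: graphE)
    then show "fst P < fst Q \<longleftrightarrow> fst (h P) < fst (h Q)" "snd P < snd Q \<longleftrightarrow> snd (h P) < snd (h Q)"
      using nth[of k] nth[of l] d[of "\<alpha> ! s k" "\<alpha> ! s l"] ne[of k] ne[of l]
      by (simp_all add: h_def s_mono)
  qed
  ultimately show ?thesis by blast
qed

lemma graph_delete_embeds:
  assumes "is_perm \<alpha>" "i < length \<alpha>"
  shows "graph x y (delete i \<alpha>) \<sqsubseteq> graph x y \<alpha>"
  using delete_embedding[OF assms, of x y] order_embedding_superset[of _ _ _ "graph x y \<alpha>"]
  by (auto simp: embeds_def)

lemma graph_minus_embeds_delete:
  assumes "is_perm \<alpha>" "i < length \<alpha>"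
  shows "graph x y \<alpha> - {(x + i, y + \<alpha> ! i)} \<sqsubseteq> graph x y (delete i \<alpha>)"
  using delete_embedding[OF assms, of x y] embeds_inverse by blast

text \<open>For a permutation \<alpha>, a translated plot fills consecutive positions and
  consecutive values, so its occurrence in the plot of \<sigma> is an interval order-isomorphic to
  \<alpha>.\<close>

definition has_interval :: "nat list \<Rightarrow> nat list \<Rightarrow> bool" where
  "has_interval \<sigma> \<alpha> \<longleftrightarrow> (\<exists>x y. graph x y \<alpha> \<subseteq> graph 0 0 \<sigma>)"

lemma unit_steps:
  fixes f :: "nat \<Rightarrow> nat"
  assumes "\<And>k. Suc k < m \<Longrightarrow> f (Suc k) = Suc (f k)" and "k < m"
  shows "f k = f 0 + k"
  using assms(2) by (induction k) (auto simp: assms(1))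

text \<open>Positions and values of the block are consecutive integers, which leaves no room for
  points of \<open>\<sigma>\<close> between those mapped to neighbouring points of the block.\<close>

lemma has_interval_if_covered:
  assumes \<sigma>: "is_perm \<sigma>" and \<alpha>: "is_perm \<alpha>" "\<alpha> \<noteq> []"
    and h: "order_embedding h (graph 0 0 \<sigma>) C"
    and cov: "graph x y \<alpha> \<subseteq> h ` graph 0 0 \<sigma>"
  shows "has_interval \<sigma> \<alpha>"
proof -
  have ord: "(i < j \<longleftrightarrow> fst (h (i, \<sigma> ! i)) < fst (h (j, \<sigma> ! j))) \<and>
      (\<sigma> ! i < \<sigma> ! j \<longleftrightarrow> snd (h (i, \<sigma> ! i)) < snd (h (j, \<sigma> ! j)))"
    if "i < length \<sigma>" "j < length \<sigma>" for i j
    using h that by (auto simp: order_embedding_def graph_def)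
  have "\<exists>i < length \<sigma>. h (i, \<sigma> ! i) = (x + k, y + \<alpha> ! k)" if "k < length \<alpha>" for k
  proof -
    have "(x + k, y + \<alpha> ! k) \<in> h ` graph 0 0 \<sigma>" using cov graphI[OF that, of x y] by blast
    then show ?thesis by (force simp: graph_def)
  qed
  then obtain idx where idx: "\<And>k. k < length \<alpha> \<Longrightarrow>
      idx k < length \<sigma> \<and> h (idx k, \<sigma> ! idx k) = (x + k, y + \<alpha> ! k)"
    by metis
  define m where "m = length \<alpha>"
  have m: "0 < m" using \<alpha> by (simp add: m_def)
  have pos: "idx k = idx 0 + k" if "k < m" for k
  proof (rule unit_steps[where f = idx, OF _ that])
    fix k assume k: "Suc k < m"
    then have i: "idx k < length \<sigma>" "idx (Suc k) < length \<sigma>"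
      "h (idx k, \<sigma> ! idx k) = (x + k, y + \<alpha> ! k)"
      "h (idx (Suc k), \<sigma> ! idx (Suc k)) = (x + Suc k, y + \<alpha> ! Suc k)"
      using idx[of k] idx[of "Suc k"] by (auto simp: m_def)
    then have "idx k < idx (Suc k)" using ord[of "idx k" "idx (Suc k)"] by simp
    moreover have False if "Suc (idx k) < idx (Suc k)"
      using ord[of "idx k" "Suc (idx k)"] ord[of "Suc (idx k)" "idx (Suc k)"] that i by simp
    ultimately show "idx (Suc k) = Suc (idx k)" by (metis Suc_lessI)
  qed
  have "\<exists>k < m. \<alpha> ! k = Suc v" if "v < m" for v
  proof -
    have "Suc v \<in> set \<alpha>" using \<alpha>(1) that by (simp add: is_perm_def m_def)
    then show ?thesis by (auto simp: in_set_conv_nth m_def)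
  qed
  \<comment> \<open>\<open>at v\<close> is the position of the value v + 1 in \<alpha>; along it the
    argument for positions can be repeated for values.\<close>
  then obtain at where at: "\<And>v. v < m \<Longrightarrow> at v < m \<and> \<alpha> ! at v = Suc v" by metis
  define val where "val v = \<sigma> ! idx (at v)" for v
  have val: "val v = val 0 + v" if "v < m" for v
  proof (rule unit_steps[where f = val, OF _ that])
    fix v assume v: "Suc v < m"
    then have i: "idx (at v) < length \<sigma>" "idx (at (Suc v)) < length \<sigma>"
      "snd (h (idx (at v), val v)) = y + Suc v"
      "snd (h (idx (at (Suc v)), val (Suc v))) = y + Suc (Suc v)"
      using idx[of "at v"] idx[of "at (Suc v)"] at[of v] at[of "Suc v"]
      by (auto simp: m_def val_def)
    then have "val v < val (Suc v)"
      using ord[of "idx (at v)" "idx (at (Suc v))"] by (simp add: val_def)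
    moreover have False if less: "Suc (val v) < val (Suc v)"
    proof -
      have "val (Suc v) \<le> length \<sigma>"
        using is_perm_nth_bounds(2)[OF \<sigma> i(2)] by (simp add: val_def)
      then have "Suc (val v) \<in> set \<sigma>" using less \<sigma> by (simp add: is_perm_def)
      then obtain j where j: "j < length \<sigma>" "\<sigma> ! j = Suc (val v)" by (auto simp: in_set_conv_nth)
      then show False
        using ord[of "idx (at v)" j] ord[of j "idx (at (Suc v))"] i less
        by (simp add: val_def)
    qed
    ultimately show "val (Suc v) = Suc (val v)" by (metis Suc_lessI)
  qed
  \<comment> \<open>\<open>val 0\<close> is the lowest value of the block in \<sigma>, and a
    translated plot starts one row above its offset; hence the offset
    \<open>val 0 - 1\<close>.\<close>
  have "\<sigma> ! (idx 0 + k) = (val 0 - 1) + \<alpha> ! k" if k: "k < m" for k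
  proof -
    obtain v where v: "\<alpha> ! k = Suc v" "v < m"
      using is_perm_nth_bounds[OF \<alpha>(1), of k] k by (cases "\<alpha> ! k") (auto simp: m_def)
    then have "at v = k"
      using at[of v] k is_perm_nth_inject[OF \<alpha>(1), of "at v" k] by (simp add: m_def)
    then have "\<sigma> ! idx k = val 0 + v" using val[OF v(2)] by (simp add: val_def)
    moreover have "1 \<le> val 0"
      using is_perm_nth_bounds(1)[OF \<sigma>] idx[of "at 0"] at[OF m] by (simp add: val_def m_def)
    ultimately show ?thesis using pos[OF k] v by simp
  qed
  moreover have "idx 0 + k < length \<sigma>" if "k < m" for k
    using idx[of k] pos[OF that] that by (simp add: m_def)
  ultimately have "graph (idx 0) (val 0 - 1) \<alpha> \<subseteq> graph 0 0 \<sigma>"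
    by (force simp: graph_def m_def)
  then show ?thesis by (auto simp: has_interval_def)
qed

text \<open>An embedding that hits every point of the block pulls it back to an interval; one that
  misses a point embeds into the plot with that point deleted. The size m may exceed the length of
  \<alpha>, so that shortened blocks can stay in the original box.\<close>

lemma below_interval_or_delete:
  assumes "\<sigma> \<in> below (C \<union> graph x y \<alpha>)"
    and \<alpha>: "is_perm \<alpha>" "\<alpha> \<noteq> []" "length \<alpha> \<le> m" and C: "avoids C x y m"
  shows "has_interval \<sigma> \<alpha> \<or> (\<exists>i < length \<alpha>. \<sigma> \<in> below (C \<union> graph x y (delete i \<alpha>)))"
proof -
  obtain h where \<sigma>: "is_perm \<sigma>" and h: "order_embedding h (graph 0 0 \<sigma>) (C \<union> graph x y \<alpha>)"
    using assms(1) by (auto simp: below_def embeds_def)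
  show ?thesis
  proof (cases "graph x y \<alpha> \<subseteq> h ` graph 0 0 \<sigma>")
    case True
    then show ?thesis using has_interval_if_covered[OF \<sigma> \<alpha>(1,2) h] by blast
  next
    case False
    then obtain i where i: "i < length \<alpha>" "(x + i, y + \<alpha> ! i) \<notin> h ` graph 0 0 \<sigma>"
      by (auto elim!: graphE)
    let ?P = "(x + i, y + \<alpha> ! i)"
    have "order_embedding h (graph 0 0 \<sigma>) (C \<union> (graph x y \<alpha> - {?P}))"
      using h i(2) unfolding order_embedding_def by blast
    then have "graph 0 0 \<sigma> \<sqsubseteq> C \<union> (graph x y \<alpha> - {?P})" by (auto simp: embeds_def)
    also have "C \<union> (graph x y \<alpha> - {?P}) \<sqsubseteq> C \<union> graph x y (delete i \<alpha>)"
    proof (rule embeds_Un_box[OF graph_minus_embeds_delete[OF \<alpha>(1) i(1)] _ _ C])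
      show "graph x y \<alpha> - {?P} \<subseteq> box x y m" using graph_subset_box[OF \<alpha>(1,3)] by blast
      show "graph x y (delete i \<alpha>) \<subseteq> box x y m"
        using is_perm_delete[OF \<alpha>(1) i(1)] i(1) \<alpha>(3) by (intro graph_subset_box) (auto simp: length_delete)
    qed
    finally show ?thesis using \<sigma> i(1) by (auto simp: below_def)
  qed
qed

text \<open>The block occupies each of its columns and rows, and in a generic set no second point
  shares a column or a row with it.\<close>

lemma avoids_minus_graph:
  assumes "generic C" "graph x y \<alpha> \<subseteq> C" "is_perm \<alpha>"
  shows "avoids (C - graph x y \<alpha>) x y (length \<alpha>)"
proof -
  have inj: "P = Q" if "P \<in> C" "Q \<in> C" "fst P = fst Q \<or> snd P = snd Q" for P Q
    using that assms(1) by (auto simp: generic_def inj_on_def)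
  have "P \<in> graph x y \<alpha>" if P: "P \<in> C" "fst P \<in> {x..<x + length \<alpha>} \<or> snd P \<in> {y<..y + length \<alpha>}" for P
  proof -
    have "\<exists>k < length \<alpha>. fst P = x + k \<or> snd P = y + \<alpha> ! k"
    proof (cases "fst P \<in> {x..<x + length \<alpha>}")
      case True
      then show ?thesis by (intro exI[of _ "fst P - x"]) auto
    next
      case False
      then have "snd P - y \<in> set \<alpha>" using P(2) assms(3) by (auto simp: is_perm_def)
      then show ?thesis using False P(2) by (auto simp: in_set_conv_nth)
    qed
    then obtain k where k: "k < length \<alpha>" "fst P = x + k \<or> snd P = y + \<alpha> ! k" by blast
    have "P = (x + k, y + \<alpha> ! k)"
      using k P(1) assms(2) graphI[OF k(1), of x y] by (intro inj) auto
    then show ?thesis using graphI[OF k(1)] by simp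
  qed
  then show ?thesis by (auto simp: avoids_def)
qed

lemma avoids_mono: "avoids C x y m \<Longrightarrow> D \<subseteq> C \<Longrightarrow> m' \<le> m \<Longrightarrow> avoids D x y m'"
  by (fastforce simp: avoids_def)

lemma avoids_Un: "avoids (C \<union> D) x y m \<longleftrightarrow> avoids C x y m \<and> avoids D x y m"
  by (auto simp: avoids_def)

lemma avoids_disjoint_box: "avoids C x y m \<Longrightarrow> A \<subseteq> box x y m \<Longrightarrow> C \<inter> A = {}"
  by (fastforce simp: avoids_def box_def)

text \<open>Given through an explicit list, so that it can be evaluated on concrete
  patterns.\<close>

definition deletions :: "nat list \<Rightarrow> nat list set" where
  "deletions \<alpha> = set (map (\<lambda>i. delete i \<alpha>) [0..<length \<alpha>])"

lemma deletions_iff: "\<alpha>' \<in> deletions \<alpha> \<longleftrightarrow> (\<exists>i < length \<alpha>. \<alpha>' = delete i \<alpha>)"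
  by (auto simp: deletions_def)

lemma bex_deletions: "(\<exists>\<alpha>' \<in> deletions \<alpha>. P \<alpha>') \<longleftrightarrow> (\<exists>i < length \<alpha>. P (delete i \<alpha>))"
  unfolding Bex_def deletions_iff by blast

section \<open>Replacing two disjoint intervals of a permutation\<close>

locale two_intervals =
  fixes \<pi> \<alpha> \<beta> :: "nat list" and x y x' y' :: nat
  assumes perms: "is_perm \<pi>" "is_perm \<alpha>" "is_perm \<beta>"
    and nonempty: "\<alpha> \<noteq> []" "\<beta> \<noteq> []"
    and intervals: "graph x y \<alpha> \<subseteq> graph 0 0 \<pi>" "graph x' y' \<beta> \<subseteq> graph 0 0 \<pi>"
    and positions: "x + length \<alpha> \<le> x' \<or> x' + length \<beta> \<le> x"
    and vals: "y + length \<alpha> \<le> y' \<or> y' + length \<beta> \<le> y"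
begin

definition rest :: points where
  "rest = graph 0 0 \<pi> - graph x y \<alpha> - graph x' y' \<beta>"

text \<open>The permutations contained in \<open>\<pi>\<close> with its blocks \<open>\<alpha>\<close> and \<open>\<beta>\<close> replaced by \<open>\<gamma>\<close> and \<open>\<delta>\<close>. The
  replacements must not be longer than the blocks, since the remaining points are not moved.\<close>

definition D :: "nat list \<Rightarrow> nat list \<Rightarrow> nat list set" where
  "D \<gamma> \<delta> = below (rest \<union> graph x y \<gamma> \<union> graph x' y' \<delta>)"

text \<open>Nonempty blocks guarantee two points, so that \<open>mu\<close> sums to 0 on
  \<open>D\<close>; the length bounds keep each block in its original box.\<close>

definition admissible :: "nat list \<Rightarrow> nat list \<Rightarrow> bool" where
  "admissible \<gamma> \<delta> \<longleftrightarrow> is_perm \<gamma> \<and> is_perm \<delta> \<and> \<gamma> \<noteq> [] \<and> \<delta> \<noteq> [] \<and>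
     length \<gamma> \<le> length \<alpha> \<and> length \<delta> \<le> length \<beta>"

lemma avoids_rest: "avoids rest x y (length \<alpha>)" "avoids rest x' y' (length \<beta>)"
  using avoids_minus_graph[OF generic_graph[OF perms(1)] intervals(1) perms(2)]
    avoids_minus_graph[OF generic_graph[OF perms(1)] intervals(2) perms(3)]
  by (auto simp: rest_def intro: avoids_mono)

text \<open>The two boxes share neither a column nor a row, so either block may count as part of the
  surroundings of the other.\<close>

lemma avoids_box: "A \<subseteq> box x y (length \<alpha>) \<Longrightarrow> avoids A x' y' (length \<beta>)"
  "A \<subseteq> box x' y' (length \<beta>) \<Longrightarrow> avoids A x y (length \<alpha>)"
  using positions vals by (fastforce simp: avoids_def box_def)+

lemma boxes:
  assumes "is_perm \<gamma>"
  shows "length \<gamma> \<le> length \<alpha> \<Longrightarrow> graph x y \<gamma> \<subseteq> box x y (length \<alpha>)"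
    and "length \<gamma> \<le> length \<beta> \<Longrightarrow> graph x' y' \<gamma> \<subseteq> box x' y' (length \<beta>)"
  using graph_subset_box assms by blast+

lemma avoids_left:
  "is_perm \<delta> \<Longrightarrow> length \<delta> \<le> length \<beta> \<Longrightarrow> avoids (rest \<union> graph x' y' \<delta>) x y (length \<alpha>)"
  using avoids_rest avoids_box(2) boxes(2) by (simp add: avoids_Un)

lemma avoids_right:
  "is_perm \<gamma> \<Longrightarrow> length \<gamma> \<le> length \<alpha> \<Longrightarrow> avoids (rest \<union> graph x y \<gamma>) x' y' (length \<beta>)"
  using avoids_rest avoids_box(1) boxes(1) by (simp add: avoids_Un)

lemma D_commute: "D \<gamma> \<delta> = below ((rest \<union> graph x' y' \<delta>) \<union> graph x y \<gamma>)"
  by (simp add: D_def Un_ac)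

lemma generic_rest: "generic rest"
  using generic_graph[OF perms(1)]
  unfolding generic_def rest_def by (meson Diff_subset finite_subset inj_on_subset)

lemma generic_config:
  assumes "admissible \<gamma> \<delta>"
  shows "generic (rest \<union> graph x y \<gamma> \<union> graph x' y' \<delta>)"
  using assms avoids_rest(1) avoids_right generic_rest generic_graph boxes
  unfolding admissible_def by (intro generic_Un) blast+

lemma card_config:
  assumes "admissible \<gamma> \<delta>"
  shows "card (rest \<union> graph x y \<gamma> \<union> graph x' y' \<delta>) = card rest + length \<gamma> + length \<delta>"
proof -
  have "(rest \<union> graph x y \<gamma>) \<inter> graph x' y' \<delta> = {}" "rest \<inter> graph x y \<gamma> = {}"
    using assms avoids_disjoint_box[OF avoids_right boxes(2)]
      avoids_disjoint_box[OF avoids_rest(1) boxes(1)] by (auto simp: admissible_def)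
  moreover have "finite rest" "finite (graph x y \<gamma>)" "finite (graph x' y' \<delta>)"
    using generic_rest by (auto simp: generic_def graph_def)
  ultimately show ?thesis by (simp add: card_Un_disjoint)
qed

lemma config_top: "rest \<union> graph x y \<alpha> \<union> graph x' y' \<beta> = graph 0 0 \<pi>"
  using intervals by (auto simp: rest_def)

lemma admissible_top: "admissible \<alpha> \<beta>"
  using perms nonempty by (simp add: admissible_def)

lemma length_top: "length \<pi> = card rest + length \<alpha> + length \<beta>"
  using card_config[OF admissible_top] by (simp add: config_top)

lemma sum_mu_D: "admissible \<gamma> \<delta> \<Longrightarrow> sum mu (D \<gamma> \<delta>) = 0"
  unfolding D_def
  by (rule sum_mu_below[OF generic_config])
    (auto simp: card_config admissible_def Suc_le_eq length_greater_0_conv[symmetric]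
      simp del: length_greater_0_conv)

lemma finite_D: "admissible \<gamma> \<delta> \<Longrightarrow> finite (D \<gamma> \<delta>)"
  unfolding D_def by (rule finite_below[OF generic_config])

lemma mu_top: "mu \<pi> = - sum mu (D \<alpha> \<beta> - {\<pi>})"
proof -
  have "2 \<le> length \<pi>"
    using nonempty length_top by (cases \<alpha>; cases \<beta>) auto
  then show ?thesis
    unfolding D_def config_top by (rule mu_eq_neg_sum_strictly_below[OF perms(1)])
qed

text \<open>This keeps \<pi> itself out of \<open>D \<gamma> \<delta>\<close> as soon as a block has
  become shorter.\<close>

lemma length_D:
  assumes "\<sigma> \<in> D \<gamma> \<delta>" "admissible \<gamma> \<delta>" "length \<gamma> + length \<delta> < length \<alpha> + length \<beta>"
  shows "length \<sigma> < length \<pi>"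
  using length_le_card_below[OF assms(1)[unfolded D_def]] generic_config[OF assms(2)]
    card_config[OF assms(2)] assms(3) length_top by (simp add: generic_def)

lemma length_D_top: "\<sigma> \<in> D \<alpha> \<beta> \<Longrightarrow> \<sigma> \<noteq> \<pi> \<Longrightarrow> length \<sigma> < length \<pi>"
  using strictly_below_length[OF perms(1)] by (simp add: D_def config_top)

lemma D_perm: "\<sigma> \<in> D \<gamma> \<delta> \<Longrightarrow> is_perm \<sigma>"
  by (simp add: D_def below_def)

lemma D_mono_left:
  assumes "admissible \<gamma> \<delta>" "\<gamma>' \<in> deletions \<gamma>"
  shows "D \<gamma>' \<delta> \<subseteq> D \<gamma> \<delta>"
proof -
  obtain i where i: "i < length \<gamma>" "\<gamma>' = delete i \<gamma>" using assms(2) by (auto simp: deletions_iff)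
  have "is_perm \<gamma>'" "length \<gamma>' \<le> length \<alpha>"
    using i assms(1) is_perm_delete length_delete by (auto simp: admissible_def)
  then show ?thesis
    unfolding D_commute
    using assms(1) i graph_delete_embeds boxes(1) avoids_left
    by (intro below_mono embeds_Un_box[where x = x and y = y and m = "length \<alpha>"])
      (auto simp: admissible_def)
qed

lemma D_mono_right:
  assumes "admissible \<gamma> \<delta>" "\<delta>' \<in> deletions \<delta>"
  shows "D \<gamma> \<delta>' \<subseteq> D \<gamma> \<delta>"
proof -
  obtain i where i: "i < length \<delta>" "\<delta>' = delete i \<delta>" using assms(2) by (auto simp: deletions_iff)
  have "is_perm \<delta>'" "length \<delta>' \<le> length \<beta>"
    using i assms(1) is_perm_delete length_delete by (auto simp: admissible_def)
  then show ?thesis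
    unfolding D_def
    using assms(1) i graph_delete_embeds boxes(2) avoids_right
    by (intro below_mono embeds_Un_box[where x = x' and y = y' and m = "length \<beta>"])
      (auto simp: admissible_def)
qed

lemma D_left:
  assumes "admissible \<gamma> \<delta>" "\<sigma> \<in> D \<gamma> \<delta>"
  shows "has_interval \<sigma> \<gamma> \<or> (\<exists>\<gamma>' \<in> deletions \<gamma>. \<sigma> \<in> D \<gamma>' \<delta>)"
  using below_interval_or_delete[OF assms(2)[unfolded D_commute] _ _ _ avoids_left] assms(1)
  unfolding admissible_def bex_deletions D_commute by blast

lemma D_right:
  assumes "admissible \<gamma> \<delta>" "\<sigma> \<in> D \<gamma> \<delta>"
  shows "has_interval \<sigma> \<delta> \<or> (\<exists>\<delta>' \<in> deletions \<delta>. \<sigma> \<in> D \<gamma> \<delta>')"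
  using below_interval_or_delete[OF assms(2)[unfolded D_def] _ _ _ avoids_right] assms(1)
  unfolding admissible_def bex_deletions D_def by blast

end

section \<open>Pairs of intervals and induction on the length\<close>

lemma has_interval_trans: "has_interval \<sigma> \<beta> \<Longrightarrow> has_interval \<beta> \<alpha> \<Longrightarrow> has_interval \<sigma> \<alpha>"
proof -
  assume "has_interval \<sigma> \<beta>" "has_interval \<beta> \<alpha>"
  then obtain x y x' y' where *: "graph x y \<beta> \<subseteq> graph 0 0 \<sigma>" "graph x' y' \<alpha> \<subseteq> graph 0 0 \<beta>"
    by (auto simp: has_interval_def)
  have "graph (x + x') (y + y') \<alpha> \<subseteq> graph x y \<beta>"
  proof
    fix P assume "P \<in> graph (x + x') (y + y') \<alpha>"
    then obtain k where k: "k < length \<alpha>" "P = (x + x' + k, y + y' + \<alpha> ! k)" by (auto elim: graphE)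
    then have "(x' + k, y' + \<alpha> ! k) \<in> graph 0 0 \<beta>" using * graphI by blast
    then show "P \<in> graph x y \<beta>" using k by (auto simp: graph_def image_iff)
  qed
  then show ?thesis using * by (auto simp: has_interval_def)
qed

lemma interval_points_agree:
  assumes "is_perm \<sigma>" "graph x y \<alpha> \<subseteq> graph 0 0 \<sigma>" "graph x' y' \<beta> \<subseteq> graph 0 0 \<sigma>"
    and "k < length \<alpha>" "l < length \<beta>"
  shows "x + k = x' + l \<longleftrightarrow> y + \<alpha> ! k = y' + \<beta> ! l"
proof -
  have "(x + k, y + \<alpha> ! k) \<in> graph 0 0 \<sigma>" "(x' + l, y' + \<beta> ! l) \<in> graph 0 0 \<sigma>"
    using assms graphI by blast+
  then show ?thesis
    using generic_graph[OF assms(1), of 0 0] by (force simp: generic_def inj_on_def)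
qed

text \<open>The points of two intervals of a permutation that share a position or a value coincide.
  For the pairs below this is compatible only with disjoint intervals.\<close>

definition separated :: "nat list \<Rightarrow> nat list \<Rightarrow> bool" where
  "separated \<alpha> \<beta> \<longleftrightarrow> is_perm \<alpha> \<and> is_perm \<beta> \<and> \<alpha> \<noteq> [] \<and> \<beta> \<noteq> [] \<and> (\<forall>x y x' y'.
     (\<forall>k < length \<alpha>. \<forall>l < length \<beta>. x + k = x' + l \<longleftrightarrow> y + \<alpha> ! k = y' + \<beta> ! l) \<longrightarrow>
     (x + length \<alpha> \<le> x' \<or> x' + length \<beta> \<le> x) \<and> (y + length \<alpha> \<le> y' \<or> y' + length \<beta> \<le> y))"

text \<open>Strong induction on the length, with the hypothesis in contrapositive form because only
  permutations with nonzero \<open>mu\<close> are compared later. Separation supplies the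
  disjointness that the locale asks for.\<close>

lemma annihilator_induct [consumes 4, case_names step]:
  assumes "is_perm \<pi>" "has_interval \<pi> \<alpha>" "has_interval \<pi> \<beta>" "separated \<alpha> \<beta>"
    and step: "\<And>\<pi> x y x' y'. two_intervals \<pi> \<alpha> \<beta> x y x' y' \<Longrightarrow>
      (\<And>\<sigma>. is_perm \<sigma> \<Longrightarrow> length \<sigma> < length \<pi> \<Longrightarrow> mu \<sigma> \<noteq> 0 \<Longrightarrow>
        \<not> (has_interval \<sigma> \<alpha> \<and> has_interval \<sigma> \<beta>)) \<Longrightarrow> mu \<pi> = 0"
  shows "mu \<pi> = 0"
  using assms(1-3)
proof (induction \<pi> rule: length_induct)
  case (1 \<pi>)
  then obtain x y x' y' where g: "graph x y \<alpha> \<subseteq> graph 0 0 \<pi>" "graph x' y' \<beta> \<subseteq> graph 0 0 \<pi>"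
    by (auto simp: has_interval_def)
  have "two_intervals \<pi> \<alpha> \<beta> x y x' y'"
    using assms(4) 1(2) g interval_points_agree[OF 1(2) g]
    unfolding two_intervals_def separated_def by blast
  then show ?case using 1(1) step by blast
qed

section \<open>Annihilating patterns\<close>

lemma is_perm_patterns [simp]:
  "is_perm [Suc 0]" "is_perm [Suc 0,2]" "is_perm [2,Suc 0]"
  "is_perm [Suc 0,3,2]" "is_perm [2,Suc 0,3]" "is_perm [2,3,Suc 0]" "is_perm [3,2,Suc 0]"
  "is_perm [2,Suc 0,4,3]" "is_perm [2,4,3,Suc 0]"
  by (auto simp: is_perm_def)

lemma separated_pairs:
  "separated [1,2] [2,1]" "separated [2,1,3] [2,4,3,1]" "separated [2,1,4,3] [2,4,3,1]"
  unfolding separated_def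
  \<comment> \<open>Once the bounded quantifiers over positions are expanded, each claim is one of
    linear arithmetic in the four offsets.\<close>
  by (simp_all, simp_all add: All_less_Suc numeral_eq_Suc) presburger+

lemma deletions_patterns [simp]:
  "deletions [Suc 0] = {[]}" "deletions [Suc 0,2] = {[Suc 0]}" "deletions [2,Suc 0] = {[Suc 0]}"
  "deletions [Suc 0,3,2] = {[Suc 0,2], [2,Suc 0]}" "deletions [2,Suc 0,3] = {[Suc 0,2], [2,Suc 0]}"
  "deletions [2,3,Suc 0] = {[Suc 0,2], [2,Suc 0]}" "deletions [3,2,Suc 0] = {[2,Suc 0]}"
  "deletions [2,Suc 0,4,3] = {[Suc 0,3,2], [2,Suc 0,3]}"
  "deletions [2,4,3,Suc 0] = {[3,2,Suc 0], [2,3,Suc 0], [Suc 0,3,2]}"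
  by (auto simp: deletions_def delete_def upt_rec)

text \<open>Through transitivity, conflicts between longer patterns are reduced to the single
  conflict between the intervals 12 and 21.\<close>

lemma has_interval_patterns:
  "has_interval [1,3,2] [2,1]" "has_interval [2,1,3] [2,1]" "has_interval [2,3,1] [1,2]"
  "has_interval [2,1,4,3] [2,1]" "has_interval [2,4,3,1] [2,1]"
proof -
  have "graph 1 1 [2,1] \<subseteq> graph 0 0 [1,3,2]" "graph 0 0 [2,1] \<subseteq> graph 0 0 [2,1,3]"
    "graph 0 1 [1,2] \<subseteq> graph 0 0 [2,3,1]" "graph 0 0 [2,1] \<subseteq> graph 0 0 [2,1,4,3]"
    "graph 1 2 [2,1] \<subseteq> graph 0 0 [2,4,3,1]"
    by (auto simp: graph_def lessThan_Suc)
  then show "has_interval [1,3,2] [2,1]" "has_interval [2,1,3] [2,1]" "has_interval [2,3,1] [1,2]"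
    "has_interval [2,1,4,3] [2,1]" "has_interval [2,4,3,1] [2,1]"
    unfolding has_interval_def by blast+
qed

section \<open>Vanishing of the Moebius function forced by intervals\<close>

lemma sum_mu_cong:
  assumes "finite A" "finite B" "\<And>\<sigma>. mu \<sigma> \<noteq> 0 \<Longrightarrow> \<sigma> \<in> A \<longleftrightarrow> \<sigma> \<in> B"
  shows "sum mu A = sum mu B"
proof -
  have "sum mu A = sum mu (A \<inter> B)"
    using assms by (intro sum.mono_neutral_right) auto
  also have "\<dots> = sum mu B"
    using assms by (intro sum.mono_neutral_left) auto
  finally show ?thesis .
qed

text \<open>Phrased for one fixed \<sigma>: instantiated at all relevant pairs of blocks, these
  facts turn the set identities below into propositional problems.\<close>

lemma (in two_intervals) D_facts:
  assumes "admissible \<gamma> \<delta>"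
  shows "(\<sigma> \<in> D \<gamma> \<delta> \<longrightarrow> has_interval \<sigma> \<gamma> \<or> (\<exists>\<gamma>' \<in> deletions \<gamma>. \<sigma> \<in> D \<gamma>' \<delta>)) \<and>
    (\<sigma> \<in> D \<gamma> \<delta> \<longrightarrow> has_interval \<sigma> \<delta> \<or> (\<exists>\<delta>' \<in> deletions \<delta>. \<sigma> \<in> D \<gamma> \<delta>')) \<and>
    (\<forall>\<gamma>' \<in> deletions \<gamma>. \<sigma> \<in> D \<gamma>' \<delta> \<longrightarrow> \<sigma> \<in> D \<gamma> \<delta>) \<and>
    (\<forall>\<delta>' \<in> deletions \<delta>. \<sigma> \<in> D \<gamma> \<delta>' \<longrightarrow> \<sigma> \<in> D \<gamma> \<delta>)"
  using D_left[OF assms] D_right[OF assms] D_mono_left[OF assms] D_mono_right[OF assms] by blast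

text \<open>Every one-point deletion of 321 is 21, so a proper subpermutation without an interval
  321 lies below the single configuration with block 21. Only one block is exchanged, so a box of
  side 3 replaces the locale.\<close>

lemma mu_interval_321:
  assumes "is_perm \<pi>" "has_interval \<pi> [3,2,1]"
  shows "mu \<pi> = 0"
  using assms
proof (induction \<pi> rule: length_induct)
  case (1 \<pi>)
  then obtain x y where g: "graph x y [3,2,1] \<subseteq> graph 0 0 \<pi>" by (auto simp: has_interval_def)
  define C where "C = graph 0 0 \<pi> - graph x y [3,2,1]"
  have av: "avoids C x y 3"
    using avoids_minus_graph[OF generic_graph[OF 1(2)] g] by (simp add: C_def flip: numeral_3_eq_3)
  have pi: "graph 0 0 \<pi> = C \<union> graph x y [3,2,1]" using g by (auto simp: C_def)
  have gC: "generic C" using generic_graph[OF 1(2), of 0 0]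
    unfolding generic_def C_def by (meson Diff_subset finite_subset inj_on_subset)
  have box: "graph x y [2,1] \<subseteq> box x y 3" "graph x y [3,2,1] \<subseteq> box x y 3"
    by (rule graph_subset_box; simp)+
  have gen: "generic (C \<union> graph x y [2,1])"
    by (rule generic_Un[OF gC _ av box(1)]) (simp add: generic_graph)
  have fin: "finite C" "finite (graph x y [2,1])" "finite (graph x y [3,2,1])"
    using gC by (auto simp: generic_def graph_def)
  have card: "card (C \<union> graph x y [2,1]) = card C + 2" "length \<pi> = card C + 3"
    using card_graph[of 0 0 \<pi>] avoids_disjoint_box[OF av box(1)] avoids_disjoint_box[OF av box(2)] fin
    by (simp_all add: card_Un_disjoint pi)
  have short: "length \<sigma> < length \<pi>" if "\<sigma> \<in> below (C \<union> graph x y [2,1])" for \<sigma>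
    using length_le_card_below[OF that] fin card by simp
  have "graph x y [2,1] \<sqsubseteq> graph x y [3,2,1]"
    using graph_delete_embeds[of "[3,2,1]" 0 x y] by (simp add: delete_def)
  then have sub: "below (C \<union> graph x y [2,1]) \<subseteq> below (graph 0 0 \<pi>)"
    unfolding pi using embeds_Un_box[OF _ box av] embeds_trans by (auto simp: below_def)
  have "\<sigma> \<in> below (graph 0 0 \<pi>) - {\<pi>} \<longleftrightarrow> \<sigma> \<in> below (C \<union> graph x y [2,1])" if "mu \<sigma> \<noteq> 0" for \<sigma>
  proof
    assume \<sigma>: "\<sigma> \<in> below (graph 0 0 \<pi>) - {\<pi>}"
    then have "is_perm \<sigma>" "length \<sigma> < length \<pi>"
      using strictly_below_length[OF 1(2)] by (auto simp: below_def)
    then have "\<not> has_interval \<sigma> [3,2,1]" using 1(1) that by blast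
    moreover have "has_interval \<sigma> [3,2,1] \<or>
        (\<exists>i < length [3,2,1::nat]. \<sigma> \<in> below (C \<union> graph x y (delete i [3,2,1])))"
      by (rule below_interval_or_delete[where m = 3]) (use \<sigma> av pi in simp_all)
    ultimately have "\<exists>\<gamma> \<in> deletions [3,2,1]. \<sigma> \<in> below (C \<union> graph x y \<gamma>)"
      unfolding bex_deletions by blast
    then show "\<sigma> \<in> below (C \<union> graph x y [2,1])" by simp
  next
    assume "\<sigma> \<in> below (C \<union> graph x y [2,1])"
    then show "\<sigma> \<in> below (graph 0 0 \<pi>) - {\<pi>}" using sub short by auto
  qed
  then have "sum mu (below (graph 0 0 \<pi>) - {\<pi>}) = sum mu (below (C \<union> graph x y [2,1]))"
    using finite_below[OF generic_graph[OF 1(2)]] finite_below[OF gen] by (intro sum_mu_cong) auto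
  \<comment> \<open>The two points of 21 alone meet the size condition of
    \<open>sum_mu_below\<close>.\<close>
  also have "\<dots> = 0" using sum_mu_below[OF gen] card by simp
  finally show ?case
    using mu_eq_neg_sum_strictly_below[OF 1(2)] card by simp
qed

text \<open>By induction a proper subpermutation with nonzero \<open>mu\<close> lacks one of the two
  intervals, and the only deletion of either is 1, so the corresponding block shrinks to 1.\<close>

lemma mu_opposing_adjacencies:
  assumes "is_perm \<pi>" "has_interval \<pi> [1,2]" "has_interval \<pi> [2,1]"
  shows "mu \<pi> = 0"
  using assms separated_pairs(1)
proof (induction rule: annihilator_induct)
  case (step \<pi> x y x' y')
  interpret two_intervals \<pi> "[1,2]" "[2,1]" x y x' y' by fact
  let ?K = "D [1] [2,1]" and ?L = "D [1,2] [1]"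
  have adm: "admissible [1] [2,1]" "admissible [1,2] [1]" "admissible [1] [1]" "admissible [1,2] [2,1]"
    unfolding admissible_def by simp_all
  have *: "(\<sigma> \<in> D [1,2] [2,1] - {\<pi>} \<longleftrightarrow> \<sigma> \<in> ?K \<union> ?L) \<and> (\<sigma> \<in> ?K \<inter> ?L \<longleftrightarrow> \<sigma> \<in> D [1] [1])"
    if "mu \<sigma> \<noteq> 0" for \<sigma>
  proof -
    have neg: "\<sigma> \<in> D [1,2] [2,1] - {\<pi>} \<longrightarrow> \<not> (has_interval \<sigma> [1,2] \<and> has_interval \<sigma> [2,1])"
      using step(2)[OF _ _ that] D_perm length_D_top by blast
    \<comment> \<open>The configurations of \<open>?K\<close> and \<open>?L\<close> have one point
      fewer than \<pi>. By monotonicity \<open>neg\<close> therefore applies to their members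
      too.\<close>
    have ne: "\<sigma> \<in> ?K \<union> ?L \<longrightarrow> \<sigma> \<noteq> \<pi>"
      using length_D[OF _ adm(1), of \<sigma>] length_D[OF _ adm(2), of \<sigma>] by auto
    show ?thesis
      using D_facts[OF adm(1), of \<sigma>] D_facts[OF adm(2), of \<sigma>] D_facts[OF adm(4), of \<sigma>] neg ne
      by simp blast
  qed
  have "sum mu (D [1,2] [2,1] - {\<pi>}) = sum mu (?K \<union> ?L)"
    using * adm finite_D by (intro sum_mu_cong) auto
  also have "\<dots> = - sum mu (?K \<inter> ?L)"
    using adm finite_D sum_mu_D by (simp add: sum_Un)
  also have "sum mu (?K \<inter> ?L) = sum mu (D [1] [1])"
    using * adm finite_D by (intro sum_mu_cong) auto
  finally show ?case using mu_top sum_mu_D[OF adm(3)] by simp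
qed

text \<open>All exclusions obtained so far. For instance, an interval 231 brings 12 and thereby
  excludes 132, 213, 2143 and 2431.\<close>

lemma nonzero_mu_facts:
  assumes "mu \<sigma> \<noteq> 0"
  shows "\<not> (has_interval \<sigma> [1,2] \<and> has_interval \<sigma> [2,1])" "\<not> has_interval \<sigma> [3,2,1]"
    "has_interval \<sigma> [1,3,2] \<longrightarrow> has_interval \<sigma> [2,1]" "has_interval \<sigma> [2,1,3] \<longrightarrow> has_interval \<sigma> [2,1]"
    "has_interval \<sigma> [2,3,1] \<longrightarrow> has_interval \<sigma> [1,2]"
    "has_interval \<sigma> [2,1,4,3] \<longrightarrow> has_interval \<sigma> [2,1]"
    "has_interval \<sigma> [2,4,3,1] \<longrightarrow> has_interval \<sigma> [2,1]"
  using assms mu_not_perm mu_opposing_adjacencies mu_interval_321 has_interval_trans has_interval_patterns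
  by blast+

text \<open>After one deletion the blocks are 12 or 21 beside 2431, or 321, 231 or 132 beside 213.
  The exclusions push members with nonzero \<open>mu\<close> into \<open>?K\<close> or
  \<open>?L\<close>, except that 231, which contains 12, can stand beside 12 without conflict; this
  case is \<open>?V\<close>.\<close>

lemma mu_interval_213_2431:
  assumes "is_perm \<pi>" "has_interval \<pi> [2,1,3]" "has_interval \<pi> [2,4,3,1]"
  shows "mu \<pi> = 0"
  using assms separated_pairs(2)
proof (induction rule: annihilator_induct)
  case (step \<pi> x y x' y')
  interpret two_intervals \<pi> "[2,1,3]" "[2,4,3,1]" x y x' y' by fact
  let ?T = "D [2,1,3] [2,4,3,1] - {\<pi>}"
  let ?K = "D [2,1] [2,4,3,1]" and ?L = "D [2,1,3] [1,3,2]" and ?V = "D [1,2] [2,3,1]"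
  \<comment> \<open>All nonempty patterns contained in 213 and in 2431 respectively, so that
    repeated deletions stay within reach of the facts.\<close>
  let ?\<Gamma> = "{[1], [1,2], [2,1], [2,1,3]} :: nat list set"
  let ?\<Delta> = "{[1], [1,2], [2,1], [2,3,1], [1,3,2], [3,2,1], [2,4,3,1]} :: nat list set"
  have adm: "\<forall>\<gamma>\<in>?\<Gamma>. \<forall>\<delta>\<in>?\<Delta>. admissible \<gamma> \<delta>"
    unfolding admissible_def by simp
  \<comment> \<open>The lines on intersections split on which of 12 and 21 is not an interval of
    \<sigma>: without 12 the blocks 12 and 231 must shrink, without 21 the blocks 21, 132, 213 and
    2431 must. For \<open>?K \<inter> ?L\<close> the exclusion of 213 together with 2431 enters as
    well.\<close>
  have *: "(\<sigma> \<in> ?T \<longleftrightarrow> \<sigma> \<in> ?K \<union> ?L \<union> ?V) \<and>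
      (\<sigma> \<in> ?K \<inter> ?V \<longleftrightarrow> \<sigma> \<in> D [1] [2,3,1]) \<and>
      (\<sigma> \<in> ?L \<inter> ?V \<longleftrightarrow> \<sigma> \<in> D [1,2] [1,2] \<union> D [1] [2,1]) \<and>
      (\<sigma> \<in> D [1,2] [1,2] \<inter> D [1] [2,1] \<longleftrightarrow> \<sigma> \<in> D [1] [1]) \<and>
      (\<sigma> \<in> ?K \<inter> ?L \<longleftrightarrow> \<sigma> \<in> D [2,1] [1,3,2] \<union> (?K \<inter> ?L \<inter> ?V)) \<and>
      (\<sigma> \<in> D [2,1] [1,3,2] \<inter> (?K \<inter> ?L \<inter> ?V) \<longleftrightarrow> \<sigma> \<in> D [1] [1,2] \<union> D [1] [2,1]) \<and>
      (\<sigma> \<in> D [1] [1,2] \<inter> D [1] [2,1] \<longleftrightarrow> \<sigma> \<in> D [1] [1])"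
    if nz: "mu \<sigma> \<noteq> 0" for \<sigma>
  proof -
    have neg: "\<sigma> \<in> ?T \<longrightarrow> \<not> (has_interval \<sigma> [2,1,3] \<and> has_interval \<sigma> [2,4,3,1])"
      using step(2)[OF _ _ nz] D_perm length_D_top by blast
    have ne: "\<sigma> \<in> ?K \<union> ?L \<union> ?V \<longrightarrow> \<sigma> \<noteq> \<pi>"
      using adm length_D[of \<sigma> "[2,1]" "[2,4,3,1]"] length_D[of \<sigma> "[2,1,3]" "[1,3,2]"]
        length_D[of \<sigma> "[1,2]" "[2,3,1]"] by auto
    have facts: "\<forall>\<gamma>\<in>?\<Gamma>. \<forall>\<delta>\<in>?\<Delta>.
      (\<sigma> \<in> D \<gamma> \<delta> \<longrightarrow> has_interval \<sigma> \<gamma> \<or> (\<exists>\<gamma>' \<in> deletions \<gamma>. \<sigma> \<in> D \<gamma>' \<delta>)) \<and>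
      (\<sigma> \<in> D \<gamma> \<delta> \<longrightarrow> has_interval \<sigma> \<delta> \<or> (\<exists>\<delta>' \<in> deletions \<delta>. \<sigma> \<in> D \<gamma> \<delta>')) \<and>
      (\<forall>\<gamma>' \<in> deletions \<gamma>. \<sigma> \<in> D \<gamma>' \<delta> \<longrightarrow> \<sigma> \<in> D \<gamma> \<delta>) \<and>
      (\<forall>\<delta>' \<in> deletions \<delta>. \<sigma> \<in> D \<gamma> \<delta>' \<longrightarrow> \<sigma> \<in> D \<gamma> \<delta>)"
      by (intro ballI D_facts) (use adm in blast)
    show ?thesis
      \<comment> \<open>After the quantifiers over blocks are expanded, the claims are propositional
        in the memberships of \<sigma> in the sets \<open>D\<close>, its intervals and the equation
        \<sigma> = \<pi>.\<close>
      using facts neg ne nonzero_mu_facts[OF nz]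
      unfolding Un_iff Int_iff Diff_iff singleton_iff ball_simps bex_simps One_nat_def deletions_patterns
      by (intro conjI; sat)
  qed
  have fin: "finite (D \<gamma> \<delta>)" and sum0: "sum mu (D \<gamma> \<delta>) = 0" if "\<gamma> \<in> ?\<Gamma>" "\<delta> \<in> ?\<Delta>" for \<gamma> \<delta>
    using that adm finite_D sum_mu_D by blast+
  have KLV: "finite ?K" "finite ?L" "finite ?V" "sum mu ?K = 0" "sum mu ?L = 0" "sum mu ?V = 0"
    by (intro fin sum0; simp)+
  have top: "sum mu ?T = sum mu (?K \<union> ?L \<union> ?V)"
    using * KLV finite_D[OF admissible_top] by (intro sum_mu_cong) auto
  have "sum mu (?K \<inter> ?V) = sum mu (D [1] [2,3,1])"
    using * KLV fin by (intro sum_mu_cong) auto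
  then have KV: "sum mu (?K \<inter> ?V) = 0" by (simp add: sum0 del: One_nat_def)
  have "sum mu (D [1,2] [1,2] \<inter> D [1] [2,1]) = sum mu (D [1] [1])"
    using * fin by (intro sum_mu_cong) auto
  then have "sum mu (D [1,2] [1,2] \<union> D [1] [2,1]) = 0"
    by (simp add: sum_Un fin sum0 del: One_nat_def)
  moreover have "sum mu (?L \<inter> ?V) = sum mu (D [1,2] [1,2] \<union> D [1] [2,1])"
    using * KLV fin by (intro sum_mu_cong) auto
  ultimately have LV: "sum mu (?L \<inter> ?V) = 0" by simp
  have "sum mu (D [1] [1,2] \<inter> D [1] [2,1]) = sum mu (D [1] [1])"
    using * fin by (intro sum_mu_cong) auto
  then have "sum mu (D [1] [1,2] \<union> D [1] [2,1]) = 0"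
    by (simp add: sum_Un fin sum0 del: One_nat_def)
  moreover have "sum mu (D [2,1] [1,3,2] \<inter> (?K \<inter> ?L \<inter> ?V)) = sum mu (D [1] [1,2] \<union> D [1] [2,1])"
    using * KLV fin by (intro sum_mu_cong) auto
  moreover have "sum mu (?K \<inter> ?L) = sum mu (D [2,1] [1,3,2] \<union> (?K \<inter> ?L \<inter> ?V))"
    using * KLV fin by (intro sum_mu_cong) auto
  \<comment> \<open>The sum over the triple intersection is never computed: inclusion-exclusion
    contains it once directly and once, with opposite sign, through
    \<open>?K \<inter> ?L\<close>.\<close>
  ultimately have KL: "sum mu (?K \<inter> ?L) = sum mu (?K \<inter> ?L \<inter> ?V)"
    using KLV by (simp add: sum_Un fin sum0 del: One_nat_def)
  have "sum mu ((?K \<union> ?L) \<inter> ?V) = sum mu (?K \<inter> ?V \<union> ?L \<inter> ?V)"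
    by (simp add: Int_Un_distrib2)
  also have "\<dots> = - sum mu (?K \<inter> ?L \<inter> ?V)"
    using KLV KV LV by (simp add: sum_Un Int_ac)
  finally have "sum mu (?K \<union> ?L \<union> ?V) = 0"
    using KLV KL by (simp add: sum_Un)
  then show ?case using top mu_top by simp
qed

text \<open>Two sets suffice here: 213 and 2431 cannot both be intervals by the preceding lemma, and
  the case of 231 beside 12 now lies in \<open>?L\<close>, since 132 contains 12 and 2431 contains
  231.\<close>

lemma mu_interval_2143_2431:
  assumes "is_perm \<pi>" "has_interval \<pi> [2,1,4,3]" "has_interval \<pi> [2,4,3,1]"
  shows "mu \<pi> = 0"
  using assms separated_pairs(3)
proof (induction rule: annihilator_induct)
  case (step \<pi> x y x' y')
  interpret two_intervals \<pi> "[2,1,4,3]" "[2,4,3,1]" x y x' y' by fact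
  let ?T = "D [2,1,4,3] [2,4,3,1] - {\<pi>}"
  let ?K = "D [2,1,4,3] [1,3,2]" and ?L = "D [1,3,2] [2,4,3,1]"
  let ?\<Gamma> = "{[1], [1,2], [2,1], [1,3,2], [2,1,3], [2,1,4,3]} :: nat list set"
  let ?\<Delta> = "{[1], [1,2], [2,1], [2,3,1], [1,3,2], [3,2,1], [2,4,3,1]} :: nat list set"
  have adm: "\<forall>\<gamma>\<in>?\<Gamma>. \<forall>\<delta>\<in>?\<Delta>. admissible \<gamma> \<delta>"
    unfolding admissible_def by simp
  have *: "(\<sigma> \<in> ?T \<longleftrightarrow> \<sigma> \<in> ?K \<union> ?L) \<and> (\<sigma> \<in> ?K \<inter> ?L \<longleftrightarrow> \<sigma> \<in> D [1,3,2] [1,3,2])"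
    if nz: "mu \<sigma> \<noteq> 0" for \<sigma>
  proof -
    have neg: "\<sigma> \<in> ?T \<longrightarrow> \<not> (has_interval \<sigma> [2,1,4,3] \<and> has_interval \<sigma> [2,4,3,1])"
      using step(2)[OF _ _ nz] D_perm length_D_top by blast
    have ne: "\<sigma> \<in> ?K \<union> ?L \<longrightarrow> \<sigma> \<noteq> \<pi>"
      using adm length_D[of \<sigma> "[2,1,4,3]" "[1,3,2]"] length_D[of \<sigma> "[1,3,2]" "[2,4,3,1]"] by auto
    \<comment> \<open>Deleting 4 or 3 from 2143 leaves 213, which may stand beside an intact
      2431.\<close>
    have neg': "\<not> (has_interval \<sigma> [2,1,3] \<and> has_interval \<sigma> [2,4,3,1])"
      using mu_interval_213_2431 mu_not_perm nz by blast
    have facts: "\<forall>\<gamma>\<in>?\<Gamma>. \<forall>\<delta>\<in>?\<Delta>.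
      (\<sigma> \<in> D \<gamma> \<delta> \<longrightarrow> has_interval \<sigma> \<gamma> \<or> (\<exists>\<gamma>' \<in> deletions \<gamma>. \<sigma> \<in> D \<gamma>' \<delta>)) \<and>
      (\<sigma> \<in> D \<gamma> \<delta> \<longrightarrow> has_interval \<sigma> \<delta> \<or> (\<exists>\<delta>' \<in> deletions \<delta>. \<sigma> \<in> D \<gamma> \<delta>')) \<and>
      (\<forall>\<gamma>' \<in> deletions \<gamma>. \<sigma> \<in> D \<gamma>' \<delta> \<longrightarrow> \<sigma> \<in> D \<gamma> \<delta>) \<and>
      (\<forall>\<delta>' \<in> deletions \<delta>. \<sigma> \<in> D \<gamma> \<delta>' \<longrightarrow> \<sigma> \<in> D \<gamma> \<delta>)"
      by (intro ballI D_facts) (use adm in blast)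
    show ?thesis
      using facts neg neg' ne nonzero_mu_facts[OF nz]
      unfolding Un_iff Int_iff Diff_iff singleton_iff ball_simps bex_simps One_nat_def deletions_patterns
      by (intro conjI; sat)
  qed
  have fin: "finite (D \<gamma> \<delta>)" and sum0: "sum mu (D \<gamma> \<delta>) = 0" if "\<gamma> \<in> ?\<Gamma>" "\<delta> \<in> ?\<Delta>" for \<gamma> \<delta>
    using that adm finite_D sum_mu_D by blast+
  have "sum mu ?T = sum mu (?K \<union> ?L)"
    using * fin finite_D[OF admissible_top] by (intro sum_mu_cong) auto
  also have "\<dots> = - sum mu (?K \<inter> ?L)"
    by (simp add: sum_Un fin sum0 del: One_nat_def)
  also have "sum mu (?K \<inter> ?L) = sum mu (D [1,3,2] [1,3,2])"
    using * fin by (intro sum_mu_cong) auto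
  finally show ?case using mu_top by (simp add: sum0 del: One_nat_def)
qed

section \<open>Blocks of an inflation as intervals\<close>

lemma has_interval_inflation:
  assumes "k < length \<tau>"
  shows "has_interval (inflation \<tau> b) (b k)"
proof -
  let ?f = "\<lambda>k. map (\<lambda>x. block_offset \<tau> b k + x) (b k)"
  have "[0..<length \<tau>] = [0..<k] @ k # [Suc k..<length \<tau>]"
    using assms by (metis le_add1 less_imp_le_nat plus_nat.add_0 upt_add_eq_append upt_conv_Cons
        le_add_diff_inverse)
  then obtain us vs where eq: "inflation \<tau> b = us @ ?f k @ vs"
    by (simp add: inflation_def)
  \<comment> \<open>Block k is the segment that follows \<open>us\<close>, with values raised by its
    block offset; these two numbers are the corner of its plot.\<close>
  have "graph (length us) (block_offset \<tau> b k) (b k) \<subseteq> graph 0 0 (inflation \<tau> b)"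
  proof
    fix P assume "P \<in> graph (length us) (block_offset \<tau> b k) (b k)"
    then obtain l where l: "l < length (b k)" "P = (length us + l, block_offset \<tau> b k + b k ! l)"
      by (auto elim: graphE)
    then show "P \<in> graph 0 0 (inflation \<tau> b)"
      using graphI[of "length us + l" "inflation \<tau> b" 0 0] by (simp add: eq nth_append)
  qed
  then show ?thesis by (auto simp: has_interval_def)
qed

theorem theorem6p2:
  shows "annihilator_pair [2, 1, 4, 3] [2, 4, 3, 1]"
  unfolding annihilator_pair_def
proof (intro conjI allI impI)
  show "is_perm [2,1,4,3]" "is_perm [2,4,3,1]" by simp_all
  fix \<tau> i j assume \<tau>: "is_perm \<tau>" "i < length \<tau>" "j < length \<tau>" "i \<noteq> j"
  let ?b = "(\<lambda>_. [1])(i := [2,1,4,3], j := [2,4,3,1])"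
  have "is_perm (inflation \<tau> ?b)"
    by (rule is_perm_inflation[OF \<tau>(1)]) simp
  \<comment> \<open>As i \<noteq> j, the update at j leaves the block at i intact.\<close>
  moreover have "has_interval (inflation \<tau> ?b) [2,1,4,3]" "has_interval (inflation \<tau> ?b) [2,4,3,1]"
    using has_interval_inflation[OF \<tau>(2), of ?b] has_interval_inflation[OF \<tau>(3), of ?b] \<tau>(4) by simp_all
  ultimately show "mobius [1] (inflation2 \<tau> i j [2,1,4,3] [2,4,3,1]) = 0"
    unfolding inflation2_def by (rule mu_interval_2143_2431)
qed simp_all

end
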